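(* Let $N$ be an integer $\geq3$ and let $\alpha,\beta\in\mathbb{C}_p$ be such that $|\beta|<|\alpha|<1$. Let $f$ and $g$ be the functions defined by $f(x)=\sum_{n\geq0}\alpha^{E((n/N)^N)}x^n$ and $g(x)=\sum_{n\geq0}\beta^{E((n/N)^N)}x^n$. Then the meromorphic function $h=f/g$ is pseudo-prime.
   Context: $p$ is a prime number and $\mathbb{C}_p$ is the completion of an algebraic closure of the field $\mathbb{Q}_p$ of $p$-adic numbers, with the usual $p$-adic absolute value $|\cdot|$. For a real number $x$, $E(x)$ denotes the integer part of $x$, the unique integer with $E(x)\leq x<E(x)+1$. $\mathcal{A}(\mathbb{C}_p)$ is the algebra of entire functions on $\mathbb{C}_p$ (power series over $\mathbb{C}_p$ converging on all of $\mathbb{C}_p$), and $\mathcal{M}(\mathbb{C}_p)$, the field of meromorphic functions in $\mathbb{C}_p$, is its field of fractions. A function $F\in\mathcal{M}(\mathbb{C}_p)$ is pseudo-prime if every factorization $F=u\circ v$ with $u,v\in\mathcal{M}(\mathbb{C}_p)$ implies that $u$ or $v$ is a rational function. *)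

theory Defs
  imports "HOL-Analysis.Analysis" "HOL-Computational_Algebra.Computational_Algebra"
begin

text \<open>
  The library's \<open>norm\<close> is reserved for real normed spaces, hence the separate constant \<open>vabs\<close>.
  The ultrametric inequality is not assumed: it follows once integers have absolute value at most 1.
\<close>

class complete_valued_field = field_char_0 + complete_space +
  fixes vabs :: "'a \<Rightarrow> real"
  assumes dist_vabs: "dist x y = vabs (x - y)"
    and vabs_mult: "vabs (x * y) = vabs x * vabs y"

definition padic_abs :: "nat \<Rightarrow> rat \<Rightarrow> real" where
  "padic_abs p q = (if q = 0 then 0 else
     (case quotient_of q of (a, b) \<Rightarrow>
       real p powi (int (multiplicity (int p) b) - int (multiplicity (int p) a))))"

text \<open>
  In a complete field whose absolute value restricts to the p-adic one on the rationals,
  the closure of the rationals is the completion of the rationals at p, that is, the field of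
  p-adic numbers.
\<close>

definition padic_numbers :: "'a::complete_valued_field set" where
  "padic_numbers = closure (range of_rat)"

definition algebraic_over :: "'a::field set \<Rightarrow> 'a set" where
  "algebraic_over S = {x. \<exists>P. P \<noteq> 0 \<and> (\<forall>i. coeff P i \<in> S) \<and> poly P x = 0}"

definition alg_closed_subset :: "'a::field set \<Rightarrow> bool" where
  "alg_closed_subset S \<longleftrightarrow>
     (\<forall>P. (\<forall>i. coeff P i \<in> S) \<and> degree P > 0 \<longrightarrow> (\<exists>x\<in>S. poly P x = 0))"

text \<open>
  The type \<^typ>\<open>'a\<close> is (a copy of) the completion of an algebraic closure of the field of
  p-adic numbers, with its usual absolute value: it is complete (by its sort), and the elements
  algebraic over the p-adic numbers form an algebraically closed field, hence an algebraic closure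
  of the p-adic numbers, which is dense. This determines \<^typ>\<open>'a\<close> up to isometric isomorphism.
\<close>

definition is_Cp :: "nat \<Rightarrow> 'a::complete_valued_field itself \<Rightarrow> bool" where
  "is_Cp p T \<longleftrightarrow> prime p \<and>
     (\<forall>q. vabs (of_rat q :: 'a) = padic_abs p q) \<and>
     alg_closed_subset (algebraic_over (padic_numbers :: 'a set)) \<and>
     closure (algebraic_over (padic_numbers :: 'a set)) = UNIV"

definition entire :: "'a::complete_valued_field fps \<Rightarrow> bool" where
  "entire f \<longleftrightarrow> (\<forall>x. summable (\<lambda>n. fps_nth f n * x ^ n))"

definition entire_eval :: "'a::complete_valued_field fps \<Rightarrow> 'a \<Rightarrow> 'a" where
  "entire_eval f x = (\<Sum>n. fps_nth f n * x ^ n)"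

text \<open>
  The field of fractions of the ring of entire functions, realised inside the field of formal
  Laurent series (expansion at 0).
\<close>

definition meromorphic_functions :: "'a::complete_valued_field fls set" where
  "meromorphic_functions =
     {fps_to_fls f / fps_to_fls g | f g. entire f \<and> entire g \<and> g \<noteq> 0}"

definition rational_function :: "'a::field fls \<Rightarrow> bool" where
  "rational_function F \<longleftrightarrow>
     (\<exists>P Q. Q \<noteq> 0 \<and> F = fps_to_fls (fps_of_poly P) / fps_to_fls (fps_of_poly Q))"

text \<open>
  \<open>has_value F x y\<close>: the meromorphic function \<open>F\<close> is regular at \<open>x\<close> with value \<open>y\<close>.
  Common zeros of a numerator and a denominator at \<open>x\<close> can be cancelled within the entire
  functions, so \<open>F\<close> has no value at \<open>x\<close> exactly when \<open>x\<close> is a pole of \<open>F\<close>.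
\<close>

definition has_value :: "'a::complete_valued_field fls \<Rightarrow> 'a \<Rightarrow> 'a \<Rightarrow> bool" where
  "has_value F x y \<longleftrightarrow> (\<exists>f g. entire f \<and> entire g \<and>
     F = fps_to_fls f / fps_to_fls g \<and> entire_eval g x \<noteq> 0 \<and>
     y = entire_eval f x / entire_eval g x)"

text \<open>The value in the projective line, \<^const>\<open>None\<close> being the point at infinity.\<close>

definition mero_eval :: "'a::complete_valued_field fls \<Rightarrow> 'a \<Rightarrow> 'a option" where
  "mero_eval F x = (if \<exists>y. has_value F x y then Some (THE y. has_value F x y) else None)"

text \<open>
  \<open>F = u \<circ> v\<close> as functions with values in the projective line. No condition is imposed at the
  poles of \<open>v\<close>, where \<open>u \<circ> v\<close> has no value a priori: if \<open>u\<close> is not rational, infinity is an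
  essential singularity of \<open>u\<close>; if \<open>u\<close> is rational, the values there are determined by the
  others.
\<close>

definition is_composition ::
  "'a::complete_valued_field fls \<Rightarrow> 'a fls \<Rightarrow> 'a fls \<Rightarrow> bool" where
  "is_composition F u v \<longleftrightarrow>
     (\<forall>x y. mero_eval v x = Some y \<longrightarrow> mero_eval F x = mero_eval u y)"

definition pseudo_prime :: "'a::complete_valued_field fls \<Rightarrow> bool" where
  "pseudo_prime F \<longleftrightarrow> F \<in> meromorphic_functions \<and>
     (\<forall>u\<in>meromorphic_functions. \<forall>v\<in>meromorphic_functions.
        is_composition F u v \<longrightarrow> rational_function u \<or> rational_function v)"

end

theory Submission
  imports Defs
begin

text \<open>
  The exponents \<open>E((n/N)^N)\<close> are eventually strictly convex in \<open>n\<close>, so on every large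
  circle \<open>f\<close> and \<open>g\<close> have at most one zero. Suppose that \<open>f / g = u \<circ> v\<close> with \<open>u\<close> not rational.
  Then \<open>u\<close> has infinitely many zeros or infinitely many poles, hence arbitrarily large ones;
  by symmetry consider zeros \<open>b\<close>. Wherever \<open>v\<close> takes the value \<open>b\<close>, \<open>f\<close> vanishes. If \<open>v\<close> had a
  pole, it would take all large values \<open>b\<close> in one fixed disc, where \<open>f\<close> has only finitely many
  zeros. So \<open>v\<close> is entire. If it is not a polynomial, there are arbitrarily large radii \<open>r\<close> at
  which two of its terms are maximal, and then \<open>v\<close> takes two different values \<open>b\<close> on the
  circle of radius \<open>r\<close>: there \<open>f\<close> would have two zeros.

  Zeros of entire functions come from an approximation argument: if \<open>f(x\<^sub>n) \<longrightarrow> 0\<close> on a disc, a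
  divided difference estimate shows that the set of the \<open>x\<^sub>n\<close> is totally bounded, so some
  subsequence converges to a zero. This yields both the algebraic closedness of the field, from
  its dense algebraically closed subset, and the zeros of power series, from those of their
  truncations.
\<close>

section \<open>Ultrametric series and entire functions\<close>

text \<open>Closed discs of this field are not compact, so a bounded sequence of approximate zeros
  has no general reason to accumulate; compactness must be extracted from the function itself. The
  information comes from the sizes of the terms \<open>vabs (fps_nth f n) * r ^ n\<close> at a
  radius \<open>r\<close>, as in the Newton polygon: the last maximal index counts the zeros in the
  closed disc, two maximal indices force a zero on the circle, and if these are adjacent and the
  only ones, the zero is a single point. For the series of the theorem consecutive terms have ratio
  |a|^s r, where s is the increment of the exponents; strictly increasing increments let at most one
  ratio be equal to 1. That a non-rational \<open>u\<close> has infinitely many zeros or poles rests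
  on a fact that fails over the complex numbers: an entire function without zeros is
  constant.\<close>

lemma vabs_0 [simp]: "vabs (0::'a::complete_valued_field) = 0"
  using dist_vabs[of "0::'a" 0] by simp

lemma vabs_conv_dist: "vabs (x::'a::complete_valued_field) = dist x 0"
  by (simp add: dist_vabs)

lemma vabs_nonneg [simp]: "0 \<le> vabs (x::'a::complete_valued_field)"
  by (simp add: vabs_conv_dist)

lemma vabs_eq_0_iff [simp]: "vabs (x::'a::complete_valued_field) = 0 \<longleftrightarrow> x = 0"
  by (simp add: vabs_conv_dist)

lemma vabs_pos_iff [simp]: "0 < vabs (x::'a::complete_valued_field) \<longleftrightarrow> x \<noteq> 0"
  by (simp add: vabs_conv_dist)

lemma vabs_1 [simp]: "vabs (1::'a::complete_valued_field) = 1"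
  using vabs_mult[of "1::'a" 1] by simp

lemma vabs_power: "vabs ((x::'a::complete_valued_field) ^ n) = vabs x ^ n"
  by (induction n) (simp_all add: vabs_mult)

lemma vabs_minus [simp]: "vabs (- x) = vabs (x::'a::complete_valued_field)"
  using dist_commute[of x 0] by (simp add: dist_vabs)

lemma vabs_minus_commute: "vabs (x - y) = vabs (y - (x::'a::complete_valued_field))"
  using vabs_minus[of "x - y"] by simp

lemma vabs_triangle: "vabs (x + y) \<le> vabs x + vabs (y::'a::complete_valued_field)"
  using dist_triangle[of x "- y" 0] by (simp add: dist_vabs)

lemma vabs_inverse: "vabs (inverse x) = inverse (vabs (x::'a::complete_valued_field))"
proof (cases "x = 0")
  case False
  then have "vabs x * vabs (inverse x) = 1"
    by (metis right_inverse vabs_1 vabs_mult)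
  then show ?thesis using False by (simp add: field_simps)
qed simp

lemma vabs_divide: "vabs (x / y) = vabs x / vabs (y::'a::complete_valued_field)"
  by (simp add: divide_inverse vabs_mult vabs_inverse)

lemma tendsto_iff_vabs:
  fixes f :: "'b \<Rightarrow> 'a::complete_valued_field"
  shows "(f \<longlongrightarrow> l) F \<longleftrightarrow> ((\<lambda>x. vabs (f x - l)) \<longlongrightarrow> 0) F"
  by (subst tendsto_dist_iff) (simp add: dist_vabs)

text \<open>The class relates \<open>dist\<close> to \<open>vabs\<close> but states no continuity.
  The rules for limits and sums require these topological classes, so continuity of the operations
  is derived from the triangle inequality.\<close>

instance complete_valued_field \<subseteq> topological_ab_group_add
proof
  fix a b :: 'a
  show "((\<lambda>x. fst x + snd x) \<longlongrightarrow> a + b) (nhds a \<times>\<^sub>F nhds b)"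
    unfolding tendsto_iff_vabs
  proof (rule tendsto_sandwich[OF _ _ tendsto_const])
    show "\<forall>\<^sub>F x in nhds a \<times>\<^sub>F nhds b.
        vabs (fst x + snd x - (a + b)) \<le> vabs (fst x - a) + vabs (snd x - b)"
      by (intro always_eventually allI) (metis add_diff_add vabs_triangle)
    have "((\<lambda>x. vabs (fst x - a) + vabs (snd x - b)) \<longlongrightarrow> 0 + 0) (nhds a \<times>\<^sub>F nhds b)"
      using filterlim_fst[of "nhds a" "nhds b"] filterlim_snd[of "nhds b" "nhds a"]
      by (intro tendsto_add) (simp_all only: tendsto_iff_vabs)
    then show "((\<lambda>x. vabs (fst x - a) + vabs (snd x - b)) \<longlongrightarrow> 0) (nhds a \<times>\<^sub>F nhds b)"
      by simp
  qed simp
  show "(uminus \<longlongrightarrow> - a) (nhds a)"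
    unfolding tendsto_iff_vabs
    using filterlim_ident[of "nhds a"]
    by (simp only: tendsto_iff_vabs minus_diff_minus vabs_minus)
qed

instance complete_valued_field \<subseteq> topological_semigroup_mult
proof
  fix a b :: 'a
  show "((\<lambda>x. fst x * snd x) \<longlongrightarrow> a * b) (nhds a \<times>\<^sub>F nhds b)"
    unfolding tendsto_iff_vabs
  proof (rule tendsto_sandwich[OF _ _ tendsto_const])
    let ?g = "\<lambda>x. vabs (fst x - a) * vabs (snd x - b) + vabs a * vabs (snd x - b)
      + vabs (fst x - a) * vabs b"
    have "fst x * snd x - a * b = ((fst x - a) * (snd x - b) + a * (snd x - b)) + (fst x - a) * b"
      for x :: "'a \<times> 'a" by (simp add: algebra_simps)
    moreover have "vabs (y + z + w) \<le> vabs y + vabs z + vabs w" for y z w :: 'a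
      using vabs_triangle[of "y + z" w] vabs_triangle[of y z] by linarith
    ultimately have "vabs (fst x * snd x - a * b) \<le> ?g x" for x :: "'a \<times> 'a"
      unfolding vabs_mult[symmetric] by metis
    then show "\<forall>\<^sub>F x in nhds a \<times>\<^sub>F nhds b. vabs (fst x * snd x - a * b) \<le> ?g x"
      by simp
    have "(?g \<longlongrightarrow> 0 * 0 + vabs a * 0 + 0 * vabs b) (nhds a \<times>\<^sub>F nhds b)"
      using filterlim_fst[of "nhds a" "nhds b"] filterlim_snd[of "nhds b" "nhds a"]
      by (intro tendsto_add tendsto_mult tendsto_const) (simp_all only: tendsto_iff_vabs)
    then show "(?g \<longlongrightarrow> 0) (nhds a \<times>\<^sub>F nhds b)" by simp
  qed simp
qed

lemma tendsto_vabs [tendsto_intros]: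
  fixes f :: "'b \<Rightarrow> 'a::complete_valued_field"
  shows "(f \<longlongrightarrow> l) F \<Longrightarrow> ((\<lambda>x. vabs (f x)) \<longlongrightarrow> vabs l) F"
  unfolding vabs_conv_dist by (intro tendsto_dist tendsto_const)

text \<open>Only finitely many terms reach \<open>c m\<close>, so the supremum is attained, and only
  finitely often. The last such index is chosen because strict inequality beyond it survives
  division by linear factors.\<close>

lemma null_sequence_last_max:
  fixes c :: "nat \<Rightarrow> real"
  assumes "c \<longlonglongrightarrow> 0" and "\<And>n. c n \<ge> 0" and "c m > 0"
  obtains i where "c i > 0" "\<And>n. c n \<le> c i" "\<And>n. n > i \<Longrightarrow> c n < c i"
proof -
  obtain K where K: "\<And>n. n \<ge> K \<Longrightarrow> c n < c m"
    using order_tendstoD(2)[OF assms(1,3)] by (auto simp: eventually_sequentially)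
  define M where "M = Max (c ` {..K + m})"
  have M: "c n \<le> M" for n
  proof (cases "n \<le> K + m")
    case False
    then have "c n < c m" by (intro K) simp
    also have "c m \<le> M" unfolding M_def by (intro Max_ge) auto
    finally show ?thesis by simp
  qed (auto simp: M_def intro!: Max_ge)
  have "M \<in> c ` {..K + m}" unfolding M_def by (intro Max_in) auto
  moreover have fin: "finite {n. c n = M}"
  proof (rule finite_subset[of _ "{..<K}"])
    show "{n. c n = M} \<subseteq> {..<K}" using K M[of m] by (force simp: not_less[symmetric])
  qed simp
  ultimately have ne: "{n. c n = M} \<noteq> {}" by auto
  define i where "i = Max {n. c n = M}"
  have i: "c i = M" using Max_in[OF fin ne] by (simp add: i_def)
  have "c n \<noteq> M" if "n > i" for n
    using Max_ge[OF fin, of n] that by (auto simp: i_def)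
  then show ?thesis using that[of i] i M assms(3) by (metis order_le_less order_less_le_trans)
qed

text \<open>Algebraic closedness is absent because it is itself obtained from the approximation of
  zeros carried out in this locale. The element of absolute value above 1 supplies points outside
  every disc.\<close>

locale nonarchimedean_field =
  fixes T :: "'a::complete_valued_field itself"
  assumes vabs_add_le: "vabs (x + y :: 'a) \<le> max (vabs x) (vabs y)"
    and ex_vabs_gt_1: "\<exists>x::'a. vabs x > 1"
begin

lemma vabs_diff_le: "vabs (x - y :: 'a) \<le> max (vabs x) (vabs y)"
  using vabs_add_le[of x "- y"] by simp

lemma vabs_add_eq_left:
  assumes "vabs (y::'a) < vabs x"
  shows "vabs (x + y) = vabs x"
  using vabs_add_le[of x y] vabs_diff_le[of "x + y" y] assms by (simp add: max_def split: if_splits)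

lemma vabs_sum_le:
  fixes t :: "'b \<Rightarrow> 'a"
  assumes "\<And>i. i \<in> A \<Longrightarrow> vabs (t i) \<le> M" and "M \<ge> 0"
  shows "vabs (sum t A) \<le> M"
  using assms
proof (induction A rule: infinite_finite_induct)
  case (insert x F)
  then have "max (vabs (t x)) (vabs (sum t F)) \<le> M" by simp
  then show ?case using order_trans[OF vabs_add_le[of "t x" "sum t F"]] insert(1,2) by simp
qed simp_all

lemma summable_iff:
  fixes t :: "nat \<Rightarrow> 'a"
  shows "summable t \<longleftrightarrow> (\<lambda>n. vabs (t n)) \<longlonglongrightarrow> 0"
proof
  assume "summable t"
  then obtain s where s: "(\<lambda>n. \<Sum>i<n. t i) \<longlonglongrightarrow> s" by (auto simp: summable_def sums_def)
  then have "(\<lambda>n. (\<Sum>i<Suc n. t i) - (\<Sum>i<n. t i)) \<longlonglongrightarrow> s - s"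
    by (intro tendsto_diff LIMSEQ_Suc)
  then have "(\<lambda>n. vabs ((\<Sum>i<Suc n. t i) - (\<Sum>i<n. t i))) \<longlonglongrightarrow> vabs (s - s)"
    by (intro tendsto_vabs)
  then show "(\<lambda>n. vabs (t n)) \<longlonglongrightarrow> 0" by simp
next
  assume t: "(\<lambda>n. vabs (t n)) \<longlonglongrightarrow> 0"
  have "Cauchy (\<lambda>n. \<Sum>i<n. t i)"
  proof (rule metric_CauchyI)
    fix e :: real assume e: "e > 0"
    then obtain K where K: "\<And>n. n \<ge> K \<Longrightarrow> vabs (t n) < e / 2"
      using order_tendstoD(2)[OF t, of "e/2"] by (auto simp: eventually_sequentially)
    have *: "dist (\<Sum>i<m. t i) (\<Sum>i<n. t i) < e" if "m \<ge> K" "m \<le> n" for m n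
    proof -
      have "(\<Sum>i<n. t i) - (\<Sum>i<m. t i) = sum t {m..<n}"
        using that(2) by (metis atLeast0LessThan sum_diff_nat_ivl zero_le)
      moreover have "vabs (sum t {m..<n}) \<le> e / 2"
        using K that e by (intro vabs_sum_le) (auto intro: less_imp_le)
      ultimately show ?thesis using e by (simp add: dist_vabs vabs_minus_commute[of "sum t {..<m}"])
    qed
    show "\<exists>M. \<forall>m\<ge>M. \<forall>n\<ge>M. dist (\<Sum>i<m. t i) (\<Sum>i<n. t i) < e"
      by (rule exI[of _ K]) (metis * dist_commute nle_le)
  qed
  then show "summable t"
    by (simp add: Cauchy_convergent_iff summable_iff_convergent)
qed

lemma vabs_suminf_le:
  fixes t :: "nat \<Rightarrow> 'a"
  assumes "summable t" and "\<And>n. vabs (t n) \<le> M"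
  shows "vabs (suminf t) \<le> M"
proof -
  have "M \<ge> 0" using assms(2)[of 0] vabs_nonneg[of "t 0"] by linarith
  then have "vabs (\<Sum>i<n. t i) \<le> M" for n using assms(2) by (intro vabs_sum_le)
  moreover have "(\<lambda>n. vabs (\<Sum>i<n. t i)) \<longlonglongrightarrow> vabs (suminf t)"
    using summable_sums[OF assms(1)] unfolding sums_def by (intro tendsto_vabs)
  ultimately show ?thesis by (intro LIMSEQ_le_const2) auto
qed

text \<open>Strictness survives the limit because a null sequence attains its largest absolute
  value.\<close>

lemma vabs_suminf_less:
  fixes t :: "nat \<Rightarrow> 'a"
  assumes "summable t" and "\<And>n. vabs (t n) < M"
  shows "vabs (suminf t) < M"
proof (cases "\<forall>n. t n = 0")
  case True
  then have "t = (\<lambda>_. 0)" by auto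
  then show ?thesis using assms(2)[of 0] by simp
next
  case False
  then obtain m where "vabs (t m) > 0" by auto
  then obtain i where "\<And>n. vabs (t n) \<le> vabs (t i)"
    using null_sequence_last_max[of "\<lambda>n. vabs (t n)" m] assms(1)
    by (metis summable_iff vabs_nonneg)
  then have "vabs (suminf t) \<le> vabs (t i)" using assms(1) by (intro vabs_suminf_le)
  then show ?thesis using assms(2)[of i] by simp
qed

lemma vabs_suminf_dominant:
  fixes t :: "nat \<Rightarrow> 'a"
  assumes "summable t" and "\<And>n. n \<noteq> i \<Longrightarrow> vabs (t n) < vabs (t i)" and "t i \<noteq> 0"
  shows "vabs (suminf t) = vabs (t i)"
proof -
  \<comment> \<open>Cancelling the \<open>i\<close>-th term leaves a sum strictly smaller than
    \<open>t i\<close>; adding it back to \<open>t i\<close> does not change the absolute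
    value.\<close>
  define s where "s = (\<lambda>n. if n = i then - t i else 0)"
  have s: "s sums (- t i)" unfolding s_def by (rule sums_single)
  have "(\<lambda>n. t n + s n) sums (suminf t + - t i)"
    using summable_sums[OF assms(1)] s by (rule sums_add)
  moreover have "vabs (suminf (\<lambda>n. t n + s n)) < vabs (t i)"
    using calculation assms by (intro vabs_suminf_less) (auto simp: s_def sums_iff)
  ultimately have "vabs (suminf t - t i) < vabs (t i)" by (simp add: sums_iff)
  then show ?thesis using vabs_add_eq_left[of "suminf t - t i" "t i"] by simp
qed

lemma ex_vabs_ge: "\<exists>x::'a. vabs x \<ge> r"
proof -
  obtain x :: 'a where "vabs x > 1" using ex_vabs_gt_1 by auto
  then obtain n where "r < vabs x ^ n" using real_arch_pow by blast
  then show ?thesis by (intro exI[of _ "x ^ n"]) (simp add: vabs_power)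
qed

text \<open>A real radius need not be the absolute value of an element; convergence at some point
  beyond it controls the terms.\<close>

lemma entire_iff:
  fixes f :: "'a fps"
  shows "entire f \<longleftrightarrow> (\<forall>r\<ge>0. (\<lambda>n. vabs (fps_nth f n) * r ^ n) \<longlonglongrightarrow> 0)"
proof
  assume f: "entire f"
  show "\<forall>r\<ge>0. (\<lambda>n. vabs (fps_nth f n) * r ^ n) \<longlonglongrightarrow> 0"
  proof (intro allI impI)
    fix r :: real assume r: "r \<ge> 0"
    obtain x :: 'a where x: "vabs x \<ge> r" using ex_vabs_ge by blast
    have "(\<lambda>n. vabs (fps_nth f n) * vabs x ^ n) \<longlonglongrightarrow> 0"
      using f by (auto simp: entire_def summable_iff vabs_mult vabs_power)
    then show "(\<lambda>n. vabs (fps_nth f n) * r ^ n) \<longlonglongrightarrow> 0"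
      using x r by (rule_tac tendsto_sandwich[OF _ _ tendsto_const])
        (auto intro!: always_eventually mult_left_mono power_mono)
  qed
next
  assume "\<forall>r\<ge>0. (\<lambda>n. vabs (fps_nth f n) * r ^ n) \<longlonglongrightarrow> 0"
  then show "entire f"
    by (auto simp: entire_def summable_iff vabs_mult vabs_power)
qed

lemma entire_summable: "entire (f::'a fps) \<Longrightarrow> summable (\<lambda>n. fps_nth f n * x ^ n)"
  by (simp add: entire_def)

lemma entire_bounded:
  assumes "entire (f::'a fps)" and "r \<ge> 0"
  obtains M where "M > 0" "\<And>n. vabs (fps_nth f n) * r ^ n \<le> M"
proof -
  have "Bseq (\<lambda>n. vabs (fps_nth f n) * r ^ n)"
    using assms by (intro convergent_imp_Bseq) (auto simp: entire_iff convergent_def)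
  then obtain M where "M > 0" "\<And>n. norm (vabs (fps_nth f n) * r ^ n) \<le> M" by (auto elim: BseqE)
  then show ?thesis using assms(2) that[of M] by simp
qed

lemma entireI_bounded:
  fixes f :: "'a fps"
  assumes "\<And>r. r > 0 \<Longrightarrow> \<exists>M. \<forall>n. vabs (fps_nth f n) * r ^ n \<le> M"
  shows "entire f"
  unfolding entire_iff
proof (intro allI impI)
  fix r :: real assume r: "r \<ge> 0"
  \<comment> \<open>A radius more than doubled leaves the geometric factor (1/2)^n; the summand 1
    keeps it positive when \<open>r\<close> is 0.\<close>
  obtain M where M: "\<And>n. vabs (fps_nth f n) * (2 * r + 1) ^ n \<le> M"
    using assms[of "2 * r + 1"] r by auto
  show "(\<lambda>n. vabs (fps_nth f n) * r ^ n) \<longlonglongrightarrow> 0"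
  proof (rule tendsto_sandwich[OF _ _ tendsto_const])
    have "vabs (fps_nth f n) * r ^ n \<le> M * (1/2) ^ n" for n
    proof -
      have "vabs (fps_nth f n) * r ^ n \<le> vabs (fps_nth f n) * ((2 * r + 1) * (1/2)) ^ n"
        using r by (intro mult_left_mono power_mono) auto
      also have "\<dots> = (vabs (fps_nth f n) * (2 * r + 1) ^ n) * (1/2) ^ n"
        by (simp only: power_mult_distrib mult.assoc)
      also have "\<dots> \<le> M * (1/2) ^ n" using M by (intro mult_right_mono) auto
      finally show ?thesis .
    qed
    then show "\<forall>\<^sub>F n in sequentially. vabs (fps_nth f n) * r ^ n \<le> M * (1/2) ^ n" by simp
    show "(\<lambda>n. M * (1/2) ^ n) \<longlonglongrightarrow> 0"
      using tendsto_mult_right_zero[OF LIMSEQ_realpow_zero[of "1/2"]] by simp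
  qed (use r in simp)
qed

lemma entire_eval_sums:
  "entire (f::'a fps) \<Longrightarrow> (\<lambda>n. fps_nth f n * x ^ n) sums entire_eval f x"
  by (simp add: entire_eval_def entire_summable summable_sums)

lemma entire_add: "entire (f::'a fps) \<Longrightarrow> entire g \<Longrightarrow> entire (f + g)"
  and entire_eval_add: "entire (f::'a fps) \<Longrightarrow> entire g \<Longrightarrow>
    entire_eval (f + g) x = entire_eval f x + entire_eval g x"
proof -
  assume f: "entire f" and g: "entire g"
  have *: "(\<lambda>n. fps_nth (f + g) n * y ^ n) sums (entire_eval f y + entire_eval g y)" for y
    using sums_add[OF entire_eval_sums[OF f] entire_eval_sums[OF g]] by (simp add: algebra_simps)
  show "entire (f + g)" unfolding entire_def using * by (blast intro: sums_summable)
  show "entire_eval (f + g) x = entire_eval f x + entire_eval g x"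
    unfolding entire_eval_def[of "f + g"] using *[of x] by (simp only: sums_iff)
qed

lemma entire_uminus: "entire (f::'a fps) \<Longrightarrow> entire (- f)"
  by (simp add: entire_iff)

lemma entire_eval_uminus: "entire (f::'a fps) \<Longrightarrow> entire_eval (- f) x = - entire_eval f x"
  using entire_eval_add[of f "- f" x] entire_uminus[of f]
  by (simp add: entire_eval_def eq_neg_iff_add_eq_0 add.commute)

lemma entire_diff: "entire (f::'a fps) \<Longrightarrow> entire g \<Longrightarrow> entire (f - g)"
  using entire_add[of f "- g"] entire_uminus[of g] by simp

lemma entire_eval_diff: "entire (f::'a fps) \<Longrightarrow> entire g \<Longrightarrow>
    entire_eval (f - g) x = entire_eval f x - entire_eval g x"
  using entire_eval_add[of f "- g" x] entire_uminus[of g] entire_eval_uminus[of g x] by simp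

lemma entire_fps_of_poly: "entire (fps_of_poly (P :: 'a poly))"
  and entire_eval_fps_of_poly: "entire_eval (fps_of_poly P) (x::'a) = poly P x"
proof -
  have *: "(\<lambda>n. fps_nth (fps_of_poly P) n * y ^ n) sums poly P y" for y
    unfolding poly_altdef fps_of_poly_nth
    by (rule sums_finite) (auto simp: coeff_eq_0 not_le)
  show "entire (fps_of_poly P)" unfolding entire_def using * by (blast intro: sums_summable)
  show "entire_eval (fps_of_poly P) x = poly P x"
    unfolding entire_eval_def using *[of x] by (simp only: sums_iff)
qed

lemma entire_fps_const: "entire (fps_const (c::'a))"
  using entire_fps_of_poly[of "[:c:]"] by (simp add: fps_of_poly_const)

lemma entire_eval_fps_const: "entire_eval (fps_const (c::'a)) x = c"
  using entire_eval_fps_of_poly[of "[:c:]" x] by (simp add: fps_of_poly_const)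

lemma entire_eval_0: "entire_eval (f::'a fps) 0 = fps_nth f 0"
proof -
  have "(\<lambda>n. fps_nth f n * 0 ^ n) sums (\<Sum>n\<in>{0}. fps_nth f n * 0 ^ n)"
    by (rule sums_finite) auto
  then show ?thesis by (simp add: entire_eval_def sums_iff)
qed

text \<open>Submultiplicativity of the Gauss norm at radius \<open>r\<close>, phrased with
  bounds.\<close>

lemma vabs_fps_mult_nth_le:
  assumes f: "\<And>n. vabs (fps_nth f n :: 'a) * r ^ n \<le> A" and g: "\<And>n. vabs (fps_nth g n) * r ^ n \<le> B"
    and r: "r \<ge> 0"
  shows "vabs (fps_nth (f * g) n) * r ^ n \<le> A * B"
proof (cases "r = 0 \<and> n > 0")
  case True
  then have "A \<ge> 0" "B \<ge> 0" using f[of n] g[of n] by (simp_all add: power_0_left)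
  then show ?thesis using True by (simp add: power_0_left)
next
  case False
  have nn: "A \<ge> 0" "B \<ge> 0"
    using order_trans[OF _ f[of 0]] order_trans[OF _ g[of 0]] r by auto
  have p: "r ^ n > 0" using False r by (cases "n = 0") auto
  have "vabs (fps_nth (f * g) n) \<le> A * B / r ^ n"
    unfolding fps_mult_nth
  proof (rule vabs_sum_le)
    fix i assume i: "i \<in> {0..n}"
    have "vabs (fps_nth f i * fps_nth g (n - i)) * r ^ n
      = (vabs (fps_nth f i) * r ^ i) * (vabs (fps_nth g (n - i)) * r ^ (n - i))"
      using i by (simp add: vabs_mult power_add[symmetric] ac_simps)
    also have "\<dots> \<le> A * B" using f g nn r by (intro mult_mono) auto
    finally show "vabs (fps_nth f i * fps_nth g (n - i)) \<le> A * B / r ^ n"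
      using p by (simp add: field_simps)
  qed (use nn p in auto)
  then show ?thesis using p by (simp add: field_simps)
qed

lemma entire_mult:
  assumes f: "entire (f::'a fps)" and g: "entire g"
  shows "entire (f * g)"
proof (rule entireI_bounded)
  fix r :: real assume "r > 0"
  then have r: "r \<ge> 0" by simp
  from entire_bounded[OF f r] entire_bounded[OF g r] obtain A B where
    "\<And>n. vabs (fps_nth f n) * r ^ n \<le> A" "\<And>n. vabs (fps_nth g n) * r ^ n \<le> B" by metis
  from vabs_fps_mult_nth_le[OF this r]
  show "\<exists>M. \<forall>n. vabs (fps_nth (f * g) n) * r ^ n \<le> M" by blast
qed

lemma entire_eval_mult:
  assumes f: "entire (f::'a fps)" and g: "entire g"
  shows "entire_eval (f * g) x = entire_eval f x * entire_eval g x"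
proof -
  define a b where "a = (\<lambda>n. fps_nth f n * x ^ n)" and "b = (\<lambda>n. fps_nth g n * x ^ n)"
  have c: "fps_nth (f * g) n * x ^ n = (\<Sum>i\<le>n. a i * b (n - i))" for n
    by (simp add: fps_mult_nth a_def b_def sum_distrib_right atLeast0AtMost)
      (auto intro!: sum.cong simp: power_add[symmetric] ac_simps)
  from entire_bounded[OF f, of "vabs x"] obtain A where A: "A > 0" "\<And>n. vabs (a n) \<le> A"
    by (auto simp: a_def vabs_mult vabs_power)
  from entire_bounded[OF g, of "vabs x"] obtain B where B: "B > 0" "\<And>n. vabs (b n) \<le> B"
    by (auto simp: b_def vabs_mult vabs_power)
  have a0: "(\<lambda>n. vabs (a n)) \<longlonglongrightarrow> 0" and b0: "(\<lambda>n. vabs (b n)) \<longlonglongrightarrow> 0"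
    using entire_summable[OF f, of x] entire_summable[OF g, of x]
    by (simp_all add: summable_iff a_def b_def)
  \<comment> \<open>The defect of the Cauchy product collects the terms outside the triangle i + j <
    n. Once n is at least 2 K, each of them has a factor of index at least K, which is small, while
    the other factor is bounded.\<close>
  let ?d = "\<lambda>n. (\<Sum>i<n. a i) * (\<Sum>i<n. b i) - (\<Sum>k<n. \<Sum>i\<le>k. a i * b (k - i))"
  have d: "?d n = (\<Sum>(i, j)\<in>{(i, j). i < n \<and> j < n \<and> n \<le> i + j}. a i * b j)" for n
  proof -
    let ?S = "{..<n} \<times> {..<n}" and ?T = "{(i, j). i + j < n}"
    have "(\<Sum>k<n. \<Sum>i\<le>k. a i * b (k - i)) = (\<Sum>(i, j)\<in>?T. a i * b j)"
      by (simp add: sum.triangle_reindex)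
    moreover have "(\<Sum>i<n. a i) * (\<Sum>i<n. b i) = (\<Sum>(i, j)\<in>?S. a i * b j)"
      by (simp add: sum_product sum.cartesian_product)
    moreover have "sum (\<lambda>(i, j). a i * b j) ?S - sum (\<lambda>(i, j). a i * b j) ?T
        = sum (\<lambda>(i, j). a i * b j) (?S - ?T)"
      by (rule sum_diff[symmetric]) auto
    moreover have "?S - ?T = {(i, j). i < n \<and> j < n \<and> n \<le> i + j}" by auto
    ultimately show ?thesis by simp
  qed
  have "(\<lambda>n. vabs (?d n)) \<longlonglongrightarrow> 0"
  proof (rule LIMSEQ_I)
    fix e :: real assume e: "e > 0"
    have "\<forall>\<^sub>F n in sequentially. vabs (a n) < e / (2 * B)"
      "\<forall>\<^sub>F n in sequentially. vabs (b n) < e / (2 * A)"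
      using order_tendstoD(2)[OF a0] order_tendstoD(2)[OF b0] A(1) B(1) e by simp_all
    then have "\<forall>\<^sub>F n in sequentially. vabs (a n) < e / (2 * B) \<and> vabs (b n) < e / (2 * A)"
      by (rule eventually_conj)
    then obtain K where K: "\<And>n. n \<ge> K \<Longrightarrow> vabs (a n) < e / (2 * B)"
      "\<And>n. n \<ge> K \<Longrightarrow> vabs (b n) < e / (2 * A)"
      by (auto simp: eventually_sequentially)
    have "vabs (?d n) \<le> e / 2" if n: "n \<ge> 2 * K" for n
      unfolding d
    proof (rule vabs_sum_le)
      fix q assume q: "q \<in> {(i, j). i < n \<and> j < n \<and> n \<le> i + j}"
      obtain i j where ij: "q = (i, j)" by force
      have "i \<ge> K \<or> j \<ge> K" using q n ij by auto
      then have "vabs (a i) * vabs (b j) \<le> e / 2"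
      proof
        assume "i \<ge> K"
        then have "vabs (a i) * vabs (b j) \<le> (e / (2 * B)) * B"
          using K(1)[of i] B e by (intro mult_mono) auto
        then show ?thesis using B(1) by simp
      next
        assume "j \<ge> K"
        then have "vabs (a i) * vabs (b j) \<le> A * (e / (2 * A))"
          using K(2)[of j] A e by (intro mult_mono) auto
        then show ?thesis using A(1) by simp
      qed
      then show "vabs (case q of (i, j) \<Rightarrow> a i * b j) \<le> e / 2" by (simp add: ij vabs_mult)
    qed (use e in simp)
    then show "\<exists>K. \<forall>n\<ge>K. norm (vabs (?d n) - 0) < e"
      using e by (intro exI[of _ "2 * K"]) fastforce
  qed
  then have "?d \<longlonglongrightarrow> 0" by (simp add: tendsto_iff_vabs)
  moreover have "(\<lambda>n. (\<Sum>i<n. a i) * (\<Sum>i<n. b i)) \<longlonglongrightarrow> entire_eval f x * entire_eval g x"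
    using entire_eval_sums[OF f, of x] entire_eval_sums[OF g, of x]
    unfolding sums_def a_def b_def by (rule tendsto_mult)
  ultimately have "(\<lambda>n. (\<Sum>i<n. a i) * (\<Sum>i<n. b i) - ?d n) \<longlonglongrightarrow> entire_eval f x * entire_eval g x - 0"
    by (intro tendsto_diff)
  then have "(\<lambda>n. fps_nth (f * g) n * x ^ n) sums (entire_eval f x * entire_eval g x)"
    by (simp add: sums_def c)
  then show ?thesis by (simp only: entire_eval_def[of "f * g"] sums_iff)
qed

section \<open>Division by linear factors\<close>

text \<open>The quotient of \<open>f - f(b)\<close> by \<open>X - b\<close>.\<close>

definition quot :: "'a fps \<Rightarrow> 'a \<Rightarrow> 'a fps" where
  "quot f b = Abs_fps (\<lambda>n. \<Sum>k. fps_nth f (Suc n + k) * b ^ k)"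

lemma summable_quot:
  assumes "entire (f::'a fps)"
  shows "summable (\<lambda>k. fps_nth f (n + k) * b ^ k)"
proof (cases "b = 0")
  case True
  have "summable (\<lambda>k. if k = 0 then fps_nth f n else 0)" by simp
  moreover have "(\<lambda>k. fps_nth f (n + k) * b ^ k) = (\<lambda>k. if k = 0 then fps_nth f n else 0)"
    using True by auto
  ultimately show ?thesis by simp
next
  case False
  have "(\<lambda>k. vabs (fps_nth f (n + k)) * vabs b ^ (n + k)) \<longlonglongrightarrow> 0"
    using LIMSEQ_ignore_initial_segment[of "\<lambda>k. vabs (fps_nth f k) * vabs b ^ k" 0 n] assms
    by (simp add: entire_iff add.commute)
  from tendsto_divide[OF this tendsto_const[of "vabs b ^ n"]] show ?thesis
    using False by (simp add: summable_iff vabs_mult vabs_power power_add)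
qed

text \<open>One step of Horner's scheme: n = 0 yields the remainder f(b), and positive n the
  recursion for the coefficients of the quotient.\<close>

lemma quot_rec:
  assumes "entire (f::'a fps)"
  shows "(\<Sum>k. fps_nth f (n + k) * b ^ k) = fps_nth f n + b * fps_nth (quot f b) n"
proof -
  have "(\<lambda>k. fps_nth f (Suc n + k) * b ^ k) sums fps_nth (quot f b) n"
    unfolding quot_def fps_nth_Abs_fps by (rule summable_sums[OF summable_quot[OF assms]])
  then have "(\<lambda>m. b * (\<Sum>k<m. fps_nth f (Suc n + k) * b ^ k)) \<longlonglongrightarrow> b * fps_nth (quot f b) n"
    unfolding sums_def by (rule tendsto_mult[OF tendsto_const])
  then have "(\<lambda>k. fps_nth f (n + Suc k) * b ^ Suc k) sums (b * fps_nth (quot f b) n)"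
    by (simp add: sums_def sum_distrib_left ac_simps)
  from sums_Suc[OF this] show ?thesis by (simp add: sums_iff add.commute)
qed

lemma fps_division:
  assumes "entire (f::'a fps)"
  shows "f = fps_const (entire_eval f b) + (fps_X - fps_const b) * quot f b"
proof (rule fps_ext)
  fix n
  show "fps_nth f n = fps_nth (fps_const (entire_eval f b) + (fps_X - fps_const b) * quot f b) n"
  proof (cases n)
    case 0
    then show ?thesis using quot_rec[OF assms, of 0 b] by (simp add: entire_eval_def algebra_simps)
  next
    case (Suc m)
    have "fps_nth (quot f b) m = fps_nth f (Suc m) + b * fps_nth (quot f b) (Suc m)"
      using quot_rec[OF assms, of "Suc m" b] by (simp add: quot_def)
    then show ?thesis using Suc by (simp add: algebra_simps)
  qed
qed

text \<open>Dividing by X - b with |b| at most \<open>r\<close> does not increase sizes at radius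
  \<open>r\<close>; the shift of the index reflects the drop in degree. The next three estimates
  apply this termwise.\<close>

lemma vabs_quot_term_le:
  assumes "vabs (b::'a) \<le> r"
  shows "vabs (fps_nth f (Suc n + k) * b ^ k) * r ^ Suc n \<le> vabs (fps_nth f (Suc n + k)) * r ^ (Suc n + k)"
proof -
  have "0 \<le> r" using assms vabs_nonneg[of b] by linarith
  have "vabs (fps_nth f (Suc n + k) * b ^ k) * r ^ Suc n
      = (vabs (fps_nth f (Suc n + k)) * r ^ Suc n) * vabs b ^ k"
    by (simp add: vabs_mult vabs_power)
  also have "\<dots> \<le> (vabs (fps_nth f (Suc n + k)) * r ^ Suc n) * r ^ k"
    using assms \<open>0 \<le> r\<close> by (intro mult_left_mono power_mono) auto
  finally show ?thesis by (simp add: power_add ac_simps)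
qed

lemma vabs_quot_nth_le:
  assumes "entire (f::'a fps)" and "vabs b \<le> r" and "r > 0"
    and "\<And>m. m > n \<Longrightarrow> vabs (fps_nth f m) * r ^ m \<le> M"
  shows "vabs (fps_nth (quot f b) n) * r ^ Suc n \<le> M"
proof -
  have "vabs (fps_nth f (Suc n + k) * b ^ k) * r ^ Suc n \<le> M" for k
    by (rule order_trans[OF vabs_quot_term_le[OF assms(2)] assms(4)]) simp
  then have "vabs (fps_nth (quot f b) n) \<le> M / r ^ Suc n"
    unfolding quot_def fps_nth_Abs_fps using assms(3)
    by (intro vabs_suminf_le summable_quot assms(1)) (simp add: pos_le_divide_eq)
  then show ?thesis using assms(3) by (simp add: pos_le_divide_eq)
qed

lemma vabs_quot_nth_less:
  assumes "entire (f::'a fps)" and "vabs b \<le> r" and "r > 0"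
    and "\<And>m. m > n \<Longrightarrow> vabs (fps_nth f m) * r ^ m < M"
  shows "vabs (fps_nth (quot f b) n) * r ^ Suc n < M"
proof -
  have "vabs (fps_nth f (Suc n + k) * b ^ k) * r ^ Suc n < M" for k
    by (rule order_le_less_trans[OF vabs_quot_term_le[OF assms(2)] assms(4)]) simp
  then have "vabs (fps_nth (quot f b) n) < M / r ^ Suc n"
    unfolding quot_def fps_nth_Abs_fps using assms(3)
    by (intro vabs_suminf_less summable_quot assms(1)) (simp add: pos_less_divide_eq)
  then show ?thesis using assms(3) by (simp add: pos_less_divide_eq)
qed

lemma vabs_quot_nth_dominant:
  assumes "entire (f::'a fps)" and "vabs b \<le> r" and "r > 0" and "fps_nth f (Suc n) \<noteq> 0"
    and "\<And>m. m > Suc n \<Longrightarrow> vabs (fps_nth f m) * r ^ m < vabs (fps_nth f (Suc n)) * r ^ Suc n"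
  shows "vabs (fps_nth (quot f b) n) = vabs (fps_nth f (Suc n))"
proof -
  have "vabs (\<Sum>k. fps_nth f (Suc n + k) * b ^ k) = vabs (fps_nth f (Suc n + 0) * b ^ 0)"
  proof (rule vabs_suminf_dominant)
    fix k :: nat assume "k \<noteq> 0"
    then have "vabs (fps_nth f (Suc n + k) * b ^ k) * r ^ Suc n < vabs (fps_nth f (Suc n)) * r ^ Suc n"
      by (intro order_le_less_trans[OF vabs_quot_term_le[OF assms(2)] assms(5)]) simp
    then show "vabs (fps_nth f (Suc n + k) * b ^ k) < vabs (fps_nth f (Suc n + 0) * b ^ 0)"
      using assms(3) by (simp add: mult_less_cancel_right)
  qed (use assms(4) summable_quot[OF assms(1), of "Suc n" b] in simp_all)
  then show ?thesis by (simp add: quot_def)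
qed

lemma entire_quot:
  assumes "entire (f::'a fps)"
  shows "entire (quot f b)"
proof (rule entireI_bounded)
  fix r :: real assume r: "r > 0"
  \<comment> \<open>The coefficient estimate needs a radius of at least |b|, so it is made at the
    larger radius \<open>s\<close>.\<close>
  define s where "s = r + vabs b"
  have s: "s > 0" "vabs b \<le> s" "r \<le> s" using r by (simp_all add: s_def add_pos_nonneg)
  then obtain M where M: "\<And>n. vabs (fps_nth f n) * s ^ n \<le> M"
    using entire_bounded[OF assms, of s] by auto
  have "vabs (fps_nth (quot f b) n) * r ^ n \<le> M / s" for n
  proof -
    have "vabs (fps_nth (quot f b) n) * r ^ n \<le> vabs (fps_nth (quot f b) n) * s ^ n"
      using r s by (intro mult_left_mono power_mono) auto
    also have "\<dots> \<le> M / s"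
      using vabs_quot_nth_le[OF assms s(2,1) M] s(1) by (simp add: field_simps)
    finally show ?thesis .
  qed
  then show "\<exists>M. \<forall>n. vabs (fps_nth (quot f b) n) * r ^ n \<le> M" by blast
qed

lemma entire_eval_division:
  assumes "entire (f::'a fps)"
  shows "entire_eval f x = entire_eval f b + (x - b) * entire_eval (quot f b) x"
proof -
  have X: "entire (fps_X - fps_const b)" "entire_eval (fps_X - fps_const b) x = x - b"
    using entire_fps_of_poly[of "[:- b, 1:]"] entire_eval_fps_of_poly[of "[:- b, 1:]" x]
    by (simp_all add: fps_of_poly_linear fps_const_neg[symmetric] del: fps_const_neg)
  have "entire_eval f x = entire_eval (fps_const (entire_eval f b) + (fps_X - fps_const b) * quot f b) x"
    using fps_division[OF assms, of b] by simp
  also have "\<dots> = entire_eval f b + (x - b) * entire_eval (quot f b) x"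
    using X by (simp add: entire_eval_add entire_eval_mult entire_fps_const entire_mult
        entire_eval_fps_const entire_quot[OF assms])
  finally show ?thesis .
qed

lemma fps_factor_root:
  assumes "entire (f::'a fps)" and "entire_eval f b = 0"
  shows "f = (fps_X - fps_const b) * quot f b"
  using fps_division[OF assms(1), of b] assms(2) by simp

section \<open>Sizes of values and dominant coefficients\<close>

lemma vabs_entire_eval_le:
  assumes "entire (f::'a fps)" and "vabs x \<le> r" and "\<And>n. vabs (fps_nth f n) * r ^ n \<le> M"
  shows "vabs (entire_eval f x) \<le> M"
  unfolding entire_eval_def
proof (rule vabs_suminf_le[OF entire_summable[OF assms(1)]])
  fix n
  have "vabs (fps_nth f n) * vabs x ^ n \<le> vabs (fps_nth f n) * r ^ n"
    using assms(2) by (intro mult_left_mono power_mono) auto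
  then show "vabs (fps_nth f n * x ^ n) \<le> M"
    using assms(3)[of n] by (simp add: vabs_mult vabs_power)
qed

lemma vabs_entire_eval_dominant:
  assumes "entire (f::'a fps)" and "vabs x > 0"
    and "\<And>n. n \<noteq> i \<Longrightarrow> vabs (fps_nth f n) * vabs x ^ n < vabs (fps_nth f i) * vabs x ^ i"
  shows "entire_eval f x \<noteq> 0"
proof -
  have "0 \<le> vabs (fps_nth f (Suc i)) * vabs x ^ Suc i" by simp
  also have "\<dots> < vabs (fps_nth f i) * vabs x ^ i" by (rule assms(3)) simp
  finally have nz: "fps_nth f i \<noteq> 0" by auto
  have "vabs (entire_eval f x) = vabs (fps_nth f i * x ^ i)"
    unfolding entire_eval_def
    using assms nz by (intro vabs_suminf_dominant entire_summable) (auto simp: vabs_mult vabs_power)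
  then show ?thesis using nz assms(2) by auto
qed

text \<open>Nothing is demanded below \<open>d\<close>, so \<open>d\<close> is only an upper bound
  for the number of zeros in the closed disc of radius \<open>r\<close>. In this form it drops by
  one when a factor X - b with |b| at most \<open>r\<close> is divided out, which makes it the
  induction variable when zeros are removed from a closed disc.\<close>

definition dominant :: "real \<Rightarrow> nat \<Rightarrow> 'a fps \<Rightarrow> bool" where
  "dominant r d f \<longleftrightarrow> fps_nth f d \<noteq> 0 \<and>
     (\<forall>n>d. vabs (fps_nth f n) * r ^ n < vabs (fps_nth f d) * r ^ d)"

lemma ex_dominant:
  assumes "entire (f::'a fps)" and "f \<noteq> 0" and "r > 0"
  obtains d where "dominant r d f" "\<And>n. vabs (fps_nth f n) * r ^ n \<le> vabs (fps_nth f d) * r ^ d"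
proof -
  obtain m where "fps_nth f m \<noteq> 0" using assms(2) by (auto simp: fps_eq_iff)
  moreover have "(\<lambda>n. vabs (fps_nth f n) * r ^ n) \<longlonglongrightarrow> 0" using assms by (simp add: entire_iff)
  ultimately obtain d where "vabs (fps_nth f d) * r ^ d > 0"
    "\<And>n. vabs (fps_nth f n) * r ^ n \<le> vabs (fps_nth f d) * r ^ d"
    "\<And>n. n > d \<Longrightarrow> vabs (fps_nth f n) * r ^ n < vabs (fps_nth f d) * r ^ d"
    using null_sequence_last_max[of "\<lambda>n. vabs (fps_nth f n) * r ^ n" m] assms(3)
    by (auto intro: less_imp_le)
  then show ?thesis using that[of d] assms(3) by (fastforce simp: dominant_def)
qed

lemma dominant_quot:
  assumes "entire (f::'a fps)" and "vabs b \<le> r" and "r > 0" and "dominant r (Suc d) f"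
  shows "dominant r d (quot f b)" "vabs (fps_nth (quot f b) d) = vabs (fps_nth f (Suc d))"
proof -
  show eq: "vabs (fps_nth (quot f b) d) = vabs (fps_nth f (Suc d))"
    using assms by (intro vabs_quot_nth_dominant[of _ _ r]) (auto simp: dominant_def)
  have "vabs (fps_nth (quot f b) n) * r ^ n < vabs (fps_nth (quot f b) d) * r ^ d" if "n > d" for n
  proof -
    have "vabs (fps_nth (quot f b) n) * r ^ Suc n < vabs (fps_nth f (Suc d)) * r ^ Suc d"
      using assms that by (intro vabs_quot_nth_less) (auto simp: dominant_def)
    then show ?thesis using assms(3) eq by (simp add: mult.left_commute[of _ r])
  qed
  then show "dominant r d (quot f b)"
    using eq assms(4) by (auto simp: dominant_def)
qed

lemma vabs_entire_eval_dominant_0: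
  assumes "entire (f::'a fps)" and "vabs x \<le> r" and "dominant r 0 f"
  shows "vabs (entire_eval f x) = vabs (fps_nth f 0)"
proof -
  have "vabs (\<Sum>n. fps_nth f n * x ^ n) = vabs (fps_nth f 0 * x ^ 0)"
  proof (rule vabs_suminf_dominant)
    fix n :: nat assume "n \<noteq> 0"
    have "vabs (fps_nth f n) * vabs x ^ n \<le> vabs (fps_nth f n) * r ^ n"
      using assms(2) by (intro mult_left_mono power_mono) auto
    also have "\<dots> < vabs (fps_nth f 0)"
      using assms(3) \<open>n \<noteq> 0\<close> by (auto simp: dominant_def)
    finally show "vabs (fps_nth f n * x ^ n) < vabs (fps_nth f 0 * x ^ 0)"
      by (simp add: vabs_mult vabs_power)
  qed (use assms entire_summable in \<open>auto simp: dominant_def\<close>)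
  then show ?thesis by (simp add: entire_eval_def)
qed

text \<open>The divided difference of order \<open>d\<close> has the absolute value of the dominant coefficient; the
  induction computes it by successive divisions.\<close>

lemma dominant_separated:
  assumes "entire (f::'a fps)" and "r > 0" and "\<delta> > 0" and "dominant r d f"
    and "finite A" and "card A = Suc d"
    and "\<And>x. x \<in> A \<Longrightarrow> vabs x \<le> r" and "\<And>x. x \<in> A \<Longrightarrow> vabs (entire_eval f x) \<le> \<epsilon>"
    and "\<And>x y. x \<in> A \<Longrightarrow> y \<in> A \<Longrightarrow> x \<noteq> y \<Longrightarrow> vabs (x - y) \<ge> \<delta>"
  shows "vabs (fps_nth f d) * \<delta> ^ d \<le> \<epsilon>"
  using assms
proof (induction d arbitrary: f A \<epsilon>)
  case 0
  then obtain x where "x \<in> A" by fastforce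
  then have "vabs (fps_nth f 0) = vabs (entire_eval f x)"
    using 0 by (intro vabs_entire_eval_dominant_0[symmetric, of _ _ r]) auto
  also have "\<dots> \<le> \<epsilon>" using 0 \<open>x \<in> A\<close> by blast
  finally show ?case by simp
next
  case (Suc d)
  obtain a B where A: "A = insert a B" "a \<notin> B" "card B = Suc d" "finite B"
    using Suc.prems(5,6) by (metis card_Suc_eq finite_insert)
  have a: "vabs a \<le> r" using Suc.prems(7) A by simp
  \<comment> \<open>At the remaining points the numerators are at most \<epsilon> by the ultrametric
    inequality and the denominators at least \<delta>, so the quotient satisfies the hypotheses with
    \<epsilon> / \<delta>.\<close>
  have "vabs (fps_nth (quot f a) d) * \<delta> ^ d \<le> \<epsilon> / \<delta>"
  proof (rule Suc.IH[of "quot f a" B])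
    show "dominant r d (quot f a)" using Suc.prems a by (intro dominant_quot)
    fix x assume x: "x \<in> B"
    have "\<epsilon> \<ge> 0" using Suc.prems(8)[of a] A vabs_nonneg[of "entire_eval f a"] by (simp del: vabs_nonneg)
    have "\<delta> \<le> vabs (x - a)" using x A Suc.prems(9)[of x a] by auto
    then have "x \<noteq> a" using Suc.prems(3) by auto
    have "entire_eval (quot f a) x = (entire_eval f x - entire_eval f a) / (x - a)"
      using entire_eval_division[OF Suc.prems(1), of x a] \<open>x \<noteq> a\<close> by simp
    then have "vabs (entire_eval (quot f a) x) = vabs (entire_eval f x - entire_eval f a) / vabs (x - a)"
      by (simp add: vabs_divide)
    also have "\<dots> \<le> \<epsilon> / \<delta>"
      using vabs_diff_le[of "entire_eval f x" "entire_eval f a"] Suc.prems(3,8) x A \<open>\<delta> \<le> vabs (x - a)\<close> \<open>\<epsilon> \<ge> 0\<close>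
      by (intro frac_le) (auto intro: order_trans)
    finally show "vabs (entire_eval (quot f a) x) \<le> \<epsilon> / \<delta>" .
  qed (use Suc.prems A entire_quot in auto)
  then show ?case
    using dominant_quot(2)[OF Suc.prems(1) a Suc.prems(2,4)] Suc.prems(3) by (simp add: field_simps)
qed

lemma approximate_zeros_imp_zero:
  fixes x :: "nat \<Rightarrow> 'a"
  assumes f: "entire f" "f \<noteq> 0" and r: "r > 0" and x: "\<And>n. vabs (x n) \<le> r"
    and lim: "(\<lambda>n. entire_eval f (x n)) \<longlonglongrightarrow> 0"
  obtains y where "vabs y \<le> r" "entire_eval f y = 0"
proof -
  obtain d where d: "dominant r d f" using ex_dominant[OF f r] .
  have lim': "(\<lambda>n. vabs (entire_eval f (x n))) \<longlonglongrightarrow> 0" using lim by (simp add: tendsto_iff_vabs)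
  have cover: "\<exists>B. finite B \<and> range x \<subseteq> (\<Union>b\<in>B. cball b \<delta>)" if \<delta>: "\<delta> > 0" for \<delta>
  proof -
    \<comment> \<open>Half of the bound that \<open>d + 1\<close> separated points would force:
      where |f| is below this, at most \<open>d\<close> points can be \<delta>-separated.\<close>
    define \<epsilon> where "\<epsilon> = vabs (fps_nth f d) * \<delta> ^ d / 2"
    have \<epsilon>: "\<epsilon> > 0" using \<delta> d by (simp add: \<epsilon>_def dominant_def)
    obtain K where K: "\<And>n. n \<ge> K \<Longrightarrow> vabs (entire_eval f (x n)) < \<epsilon>"
      using order_tendstoD(2)[OF lim' \<epsilon>] by (auto simp: eventually_sequentially)
    define sep where "sep = (\<lambda>A. finite A \<and> A \<subseteq> x ` {K..} \<and>
      (\<forall>u\<in>A. \<forall>v\<in>A. u \<noteq> v \<longrightarrow> vabs (u - v) \<ge> \<delta>))"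
    have "card A < Suc d" if A: "sep A" for A
    proof (rule ccontr)
      assume "\<not> card A < Suc d"
      then obtain C where C: "C \<subseteq> A" "card C = Suc d" "finite C"
        by (meson not_less obtain_subset_with_card_n)
      have "vabs (fps_nth f d) * \<delta> ^ d \<le> \<epsilon>"
      proof (rule dominant_separated[OF f(1) r \<delta> d C(3,2)])
        show "vabs u \<le> r" "vabs (entire_eval f u) \<le> \<epsilon>" if "u \<in> C" for u
          using A C(1) x that by (auto simp: sep_def dest!: subsetD dest: K[THEN less_imp_le])
        show "\<delta> \<le> vabs (u - v)" if "u \<in> C" "v \<in> C" "u \<noteq> v" for u v
          using A C(1) that unfolding sep_def by blast
      qed
      then show False using \<epsilon> unfolding \<epsilon>_def by linarith
    qed
    moreover have "sep {}" by (simp add: sep_def)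
    \<comment> \<open>A largest separated set exists because the cardinalities are bounded. By
      maximality every other point of the tail is within \<delta> of it; the finitely many earlier
      points become additional centres.\<close>
    ultimately obtain A where A: "sep A" "\<And>B. sep B \<Longrightarrow> card B \<le> card A"
      using ex_has_greatest_nat[of sep "{}" card "Suc d"] by (metis less_imp_le)
    have "range x \<subseteq> (\<Union>b\<in>A \<union> x ` {..<K}. cball b \<delta>)"
    proof safe
      fix n
      show "x n \<in> (\<Union>b\<in>A \<union> x ` {..<K}. cball b \<delta>)"
      proof (cases "n < K \<or> x n \<in> A")
        case False
        then have "card (insert (x n) A) > card A" using A(1) by (simp add: sep_def)
        then have "\<not> sep (insert (x n) A)" using A(2) by (metis not_le)
        then obtain u where "u \<in> A" "vabs (x n - u) < \<delta> \<or> vabs (u - x n) < \<delta>"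
          using A(1) False by (auto simp: sep_def not_le not_less) (metis not_le)
        then show ?thesis by (auto simp: dist_vabs vabs_minus_commute[of "x n"] intro!: bexI[of _ u])
      next
        case True
        then have "x n \<in> A \<union> x ` {..<K}" by auto
        then show ?thesis using \<delta> by (intro UN_I[of "x n"]) auto
      qed
    qed
    then show ?thesis using A(1) by (intro exI[of _ "A \<union> x ` {..<K}"]) (auto simp: sep_def)
  qed
  have "compact (closure (range x))"
    unfolding compact_eq_totally_bounded
  proof (intro conjI allI impI)
    show "complete (closure (range x))" by (simp add: complete_eq_closed)
    fix e :: real assume "e > 0"
    then obtain B where B: "finite B" "range x \<subseteq> (\<Union>b\<in>B. cball b (e / 2))"
      using cover[of "e / 2"] by auto
    have "closure (range x) \<subseteq> (\<Union>b\<in>B. cball b (e / 2))"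
      using B by (intro closure_minimal closed_UN) auto
    also have "\<dots> \<subseteq> (\<Union>b\<in>B. ball b e)" using \<open>e > 0\<close> by fastforce
    finally show "\<exists>k. finite k \<and> closure (range x) \<subseteq> (\<Union>b\<in>k. ball b e)" using B(1) by blast
  qed
  then obtain l \<rho> where l: "strict_mono \<rho>" "(x \<circ> \<rho>) \<longlonglongrightarrow> l"
    unfolding compact_def using closure_subset by (metis range_subsetD)
  have vl: "vabs l \<le> r"
    using tendsto_vabs[OF l(2)] x by (intro LIMSEQ_le_const2) (auto simp: o_def)
  \<comment> \<open>A bound for the divided difference on the disc gives |f(x) - f(l)| <= |x - l| M,
    the continuity needed at the limit.\<close>
  obtain M where M: "M > 0" "\<And>n. vabs (fps_nth (quot f l) n) * r ^ n \<le> M"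
    using entire_bounded[OF entire_quot[OF f(1)], of r l] r by auto
  have "(\<lambda>n. vabs (entire_eval f (x (\<rho> n)) - entire_eval f l)) \<longlonglongrightarrow> 0"
  proof (rule tendsto_sandwich[OF _ _ tendsto_const])
    show "\<forall>\<^sub>F n in sequentially. vabs (entire_eval f (x (\<rho> n)) - entire_eval f l) \<le> vabs (x (\<rho> n) - l) * M"
    proof (intro always_eventually allI)
      fix n
      have "entire_eval f (x (\<rho> n)) - entire_eval f l = (x (\<rho> n) - l) * entire_eval (quot f l) (x (\<rho> n))"
        using entire_eval_division[OF f(1), of "x (\<rho> n)" l] by simp
      then show "vabs (entire_eval f (x (\<rho> n)) - entire_eval f l) \<le> vabs (x (\<rho> n) - l) * M"
        using vabs_entire_eval_le[OF entire_quot[OF f(1)] x M(2)] by (simp add: vabs_mult mult_left_mono)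
    qed
    have "(\<lambda>n. vabs (x (\<rho> n) - l) * M) \<longlonglongrightarrow> 0 * M"
      using l(2) by (intro tendsto_mult tendsto_const) (simp add: tendsto_iff_vabs[of _ l] o_def)
    then show "(\<lambda>n. vabs (x (\<rho> n) - l) * M) \<longlonglongrightarrow> 0" by simp
  qed simp
  then have "(\<lambda>n. entire_eval f (x (\<rho> n))) \<longlonglongrightarrow> entire_eval f l" by (simp add: tendsto_iff_vabs[of _ "entire_eval f l"])
  moreover have "(\<lambda>n. entire_eval f (x (\<rho> n))) \<longlonglongrightarrow> 0"
    using LIMSEQ_subseq_LIMSEQ[OF lim l(1)] by (simp add: o_def)
  ultimately have "entire_eval f l = 0" by (rule LIMSEQ_unique)
  then show ?thesis using that vl by blast
qed

end

section \<open>Existence and location of zeros\<close>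

lemma power_dominance_mono:
  fixes A B s t :: real
  assumes "n < m" and "0 < s" and "s < t" and "B > 0" and "A * s ^ n \<le> B * s ^ m"
  shows "A * t ^ n < B * t ^ m"
proof -
  have m: "x ^ m = x ^ n * x ^ (m - n)" for x :: real
    using assms(1) by (simp flip: power_add)
  have "s ^ n * A \<le> s ^ n * (B * s ^ (m - n))" using assms(5) by (simp add: m ac_simps)
  then have "A \<le> B * s ^ (m - n)" using assms(2) by (subst (asm) mult_le_cancel_left_pos) auto
  also have "\<dots> < B * t ^ (m - n)"
    using assms by (intro mult_strict_left_mono power_strict_mono) auto
  finally have "t ^ n * A < t ^ n * (B * t ^ (m - n))"
    using assms by (intro mult_strict_left_mono) auto
  then show ?thesis by (simp add: m ac_simps)
qed

context nonarchimedean_field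
begin

lemma vabs_sum_less:
  fixes t :: "'b \<Rightarrow> 'a"
  assumes "\<And>i. i \<in> A \<Longrightarrow> vabs (t i) < M" and "M > 0"
  shows "vabs (sum t A) < M"
  using assms
proof (induction A rule: infinite_finite_induct)
  case (insert x F)
  then have "max (vabs (t x)) (vabs (sum t F)) < M" by simp
  then show ?case using order_le_less_trans[OF vabs_add_le[of "t x" "sum t F"]] insert(1,2) by simp
qed simp_all

text \<open>Polynomials over \<open>S\<close> that approximate the given one have roots in a common
  disc, and these roots are approximate zeros of the given polynomial.\<close>

lemma dense_alg_closed_subset_imp_root:
  fixes S :: "'a set" and P :: "'a poly"
  assumes S: "alg_closed_subset S" "closure S = UNIV" "0 \<in> S" "1 \<in> S" and P: "degree P > 0"
  obtains x where "poly P x = 0"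
proof -
  define d where "d = degree P"
  define c where "c = (\<lambda>i. coeff P i / lead_coeff P)"
  define B where "B = (\<Sum>i<d. vabs (c i))"
  have B: "vabs (c i) \<le> B" if "i < d" for i
    unfolding B_def using that by (intro member_le_sum) auto
  have Bn: "B \<ge> 0" unfolding B_def by (simp add: sum_nonneg)
  \<comment> \<open>The approximating coefficients have absolute value at most B + 1, hence at most
    \<open>r\<close>; since \<open>r\<close> is also at least 1, the term of degree \<open>d\<close>
    beats all lower ones outside the disc of radius \<open>r\<close>.\<close>
  define r where "r = B + 2"
  have r: "r \<ge> 1" using Bn by (simp add: r_def)
  have "\<exists>a. a \<in> S \<and> vabs (a - c i) < 1 / real (Suc n)" for n i
  proof -
    have "\<forall>e>0. \<exists>y\<in>S. vabs (y - c i) < e"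
      using S(2) closure_approachable[of "c i" S] by (simp add: dist_vabs)
    moreover have "1 / real (Suc n) > 0" by simp
    ultimately show ?thesis by blast
  qed
  then have "\<forall>q. \<exists>y. y \<in> S \<and> vabs (y - c (snd q)) < 1 / real (Suc (fst q))" by blast
  then obtain a' where a': "\<forall>q. a' q \<in> S \<and> vabs (a' q - c (snd q)) < 1 / real (Suc (fst q))"
    by (rule exE[OF choice])
  define a where "a = (\<lambda>n i. a' (n, i))"
  have a: "a n i \<in> S" "vabs (a n i - c i) < 1 / real (Suc n)" for n i
    using a'[rule_format, of "(n, i)"] by (simp_all add: a_def)
  have a_le: "vabs (a n i) \<le> r" if "i < d" for n i
  proof -
    have "vabs (a n i) \<le> vabs (a n i - c i) + vabs (c i)" using vabs_triangle[of "a n i - c i" "c i"] by simp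
    also have "\<dots> \<le> 1 + B"
    proof (rule add_mono[OF _ B[OF that]])
      have "1 / real (Suc n) \<le> 1" by simp
      then show "vabs (a n i - c i) \<le> 1" using a(2)[of n i] by linarith
    qed
    finally show ?thesis by (simp add: r_def)
  qed
  \<comment> \<open>The leading coefficient stays exactly 1, so the degree is kept and the bound on
    the roots is uniform in \<open>n\<close>.\<close>
  define Q where "Q = (\<lambda>n. monom 1 d + (\<Sum>i<d. monom (a n i) i))"
  have coeff_Q: "coeff (Q n) k = (if k = d then 1 else if k < d then a n k else 0)" for n k
    by (auto simp: Q_def coeff_sum)
  have "degree (Q n) \<ge> d" for n by (rule le_degree) (simp add: coeff_Q)
  then have "degree (Q n) > 0" for n using P by (metis d_def less_le_trans)
  moreover have "coeff (Q n) k \<in> S" for n k using a(1) S(3,4) by (simp add: coeff_Q)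
  ultimately have "\<exists>x. poly (Q n) x = 0" for n
    using S(1) unfolding alg_closed_subset_def by blast
  then obtain x where x: "\<And>n. poly (Q n) (x n) = 0" by metis
  have xr: "vabs (x n) \<le> r" for n
  proof (rule ccontr)
    assume "\<not> vabs (x n) \<le> r"
    then have xn: "vabs (x n) > r" "vabs (x n) > 0" using r by linarith+
    have "entire_eval (fps_of_poly (Q n)) (x n) \<noteq> 0"
    proof (rule vabs_entire_eval_dominant[where i = d])
      fix k assume "k \<noteq> d"
      show "vabs (fps_nth (fps_of_poly (Q n)) k) * vabs (x n) ^ k
        < vabs (fps_nth (fps_of_poly (Q n)) d) * vabs (x n) ^ d"
      proof (cases "k < d")
        case True
        have "vabs (a n k) * vabs (x n) ^ k \<le> r * vabs (x n) ^ k"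
          using a_le[OF True] by (intro mult_right_mono) auto
        also have "\<dots> < vabs (x n) * vabs (x n) ^ k"
          using xn by (intro mult_strict_right_mono zero_less_power)
        also have "\<dots> = vabs (x n) ^ Suc k" by simp
        also have "\<dots> \<le> vabs (x n) ^ d" using True xn r by (intro power_increasing) auto
        finally show ?thesis using True by (simp add: coeff_Q)
      next
        case False
        then show ?thesis using \<open>k \<noteq> d\<close> zero_less_power[OF xn(2), of d] by (simp add: coeff_Q)
      qed
    qed (use xn r entire_fps_of_poly in auto)
    then show False using x by (simp add: entire_eval_fps_of_poly)
  qed
  define P' where "P' = smult (inverse (lead_coeff P)) P"
  have P'0: "P' \<noteq> 0" using P by (auto simp: P'_def)
  have c: "coeff P' i = c i" for i by (simp add: P'_def c_def divide_inverse mult.commute)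
  have "degree P' = d" using P by (auto simp: P'_def d_def)
  then have P'_eq: "poly P' y = (\<Sum>i<d. c i * y ^ i) + y ^ d" for y
    using P by (auto simp: poly_altdef c c_def d_def lessThan_Suc_atMost[symmetric])
  have "(\<lambda>n. vabs (poly P' (x n))) \<longlonglongrightarrow> 0"
  proof (rule tendsto_sandwich[OF _ _ tendsto_const])
    have "vabs (poly P' (x n)) \<le> inverse (real (Suc n)) * r ^ d" for n
    proof -
      have "poly P' (x n) = poly P' (x n) - poly (Q n) (x n)" by (simp add: x)
      also have "\<dots> = (\<Sum>i<d. (c i - a n i) * x n ^ i)"
        by (simp add: P'_eq Q_def poly_monom poly_sum sum_subtractf algebra_simps)
      also have "vabs \<dots> \<le> inverse (real (Suc n)) * r ^ d"
      proof (rule vabs_sum_le)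
        fix i assume "i \<in> {..<d}"
        have "vabs (c i - a n i) * vabs (x n) ^ i \<le> inverse (real (Suc n)) * r ^ i"
          using a(2)[of n i] xr[of n] r by (intro mult_mono power_mono)
            (auto simp: vabs_minus_commute[of "c i"] inverse_eq_divide intro: less_imp_le)
        also have "\<dots> \<le> inverse (real (Suc n)) * r ^ d"
          using \<open>i \<in> {..<d}\<close> r by (intro mult_left_mono power_increasing) auto
        finally show "vabs ((c i - a n i) * x n ^ i) \<le> inverse (real (Suc n)) * r ^ d"
          by (simp add: vabs_mult vabs_power)
      qed (use r in auto)
      finally show ?thesis .
    qed
    then show "\<forall>\<^sub>F n in sequentially. vabs (poly P' (x n)) \<le> inverse (real (Suc n)) * r ^ d" by simp
    show "(\<lambda>n. inverse (real (Suc n)) * r ^ d) \<longlonglongrightarrow> 0"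
      using tendsto_mult_left_zero[OF LIMSEQ_inverse_real_of_nat] by blast
  qed simp
  then have lim: "(\<lambda>n. entire_eval (fps_of_poly P') (x n)) \<longlonglongrightarrow> 0"
    by (simp add: entire_eval_fps_of_poly tendsto_iff_vabs[of _ 0])
  have ne: "fps_of_poly P' \<noteq> 0" using P'0 fps_of_poly_eq_iff[of P' 0] by simp
  have r0: "r > 0" using r by simp
  obtain y where "entire_eval (fps_of_poly P') y = 0"
    by (rule approximate_zeros_imp_zero[OF entire_fps_of_poly ne r0 xr lim])
  then have "poly P y = 0" using P by (auto simp: entire_eval_fps_of_poly P'_def)
  then show ?thesis by (rule that)
qed

lemma finite_zeros_disc:
  assumes "entire (f::'a fps)" and "f \<noteq> 0"
  shows "finite {x. vabs x \<le> r \<and> entire_eval f x = 0}"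
proof -
  define s where "s = max r 1"
  have s: "s > 0" by (simp add: s_def)
  obtain d where "dominant s d f" using ex_dominant[OF assms s] .
  then have "finite {x. vabs x \<le> s \<and> entire_eval f x = 0}" using assms(1)
  proof (induction d arbitrary: f)
    case 0
    then have "{x. vabs x \<le> s \<and> entire_eval f x = 0} = {}"
      using vabs_entire_eval_dominant_0[of f _ s] by (fastforce simp: dominant_def)
    then show ?case by (simp only: finite.emptyI)
  next
    case (Suc d)
    show ?case
    proof (cases "{x. vabs x \<le> s \<and> entire_eval f x = 0} = {}")
      case True
      then show ?thesis by (simp only: finite.emptyI)
    next
      case False
      then obtain b where b: "vabs b \<le> s" "entire_eval f b = 0" by blast
      have "finite {x. vabs x \<le> s \<and> entire_eval (quot f b) x = 0}"
        using dominant_quot(1)[OF Suc.prems(2) b(1) s Suc.prems(1)] entire_quot[OF Suc.prems(2)]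
        by (rule Suc.IH)
      moreover have "{x. vabs x \<le> s \<and> entire_eval f x = 0}
          \<subseteq> insert b {x. vabs x \<le> s \<and> entire_eval (quot f b) x = 0}"
        using entire_eval_division[OF Suc.prems(2), of _ b] b(2) by auto
      ultimately show ?thesis by (meson finite_insert finite_subset)
    qed
  qed
  moreover have "{x. vabs x \<le> r \<and> entire_eval f x = 0} \<subseteq> {x. vabs x \<le> s \<and> entire_eval f x = 0}"
    by (auto simp: s_def)
  ultimately show ?thesis by (rule rev_finite_subset)
qed

text \<open>For a zero \<open>b\<close> this expresses a coefficient of the quotient by the initial
  part of \<open>f\<close> instead of the tail. For indices below the maximal terms the tail
  contains those terms and gives no strict bound, but the initial part does.\<close>

lemma quot_partial_sum:
  assumes "entire (f::'a fps)"
  shows "(\<Sum>m\<le>n. fps_nth f m * b ^ m) + fps_nth (quot f b) n * b ^ Suc n = entire_eval f b"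
proof (induction n)
  case 0
  then show ?case using quot_rec[OF assms, of 0 b] by (simp add: entire_eval_def mult.commute)
next
  case (Suc n)
  have "fps_nth (quot f b) n = fps_nth f (Suc n) + b * fps_nth (quot f b) (Suc n)"
    using quot_rec[OF assms, of "Suc n" b] by (simp add: quot_def)
  then show ?case using Suc by (simp add: algebra_simps)
qed

text \<open>After division by X - x, coefficient \<open>i\<close> of the quotient inherits the
  maximal size. The coefficients above it are controlled by the tail of \<open>f\<close>, those
  below it by the initial part, and both are strictly smaller. A single largest term excludes a
  second zero on the circle.\<close>

lemma zero_on_circle_unique:
  assumes f: "entire (f::'a fps)" and r: "r > 0"
    and le: "vabs (fps_nth f i) * r ^ i \<le> vabs (fps_nth f (Suc i)) * r ^ Suc i"
    and less: "\<And>n. n \<noteq> i \<Longrightarrow> n \<noteq> Suc i \<Longrightarrow>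
      vabs (fps_nth f n) * r ^ n < vabs (fps_nth f (Suc i)) * r ^ Suc i"
    and x: "vabs x = r" "entire_eval f x = 0" and y: "vabs y = r" "entire_eval f y = 0"
  shows "x = y"
proof (rule ccontr)
  assume "x \<noteq> y"
  then have "entire_eval (quot f x) y = 0"
    using entire_eval_division[OF f, of y x] x y by simp
  let ?M = "vabs (fps_nth f (Suc i)) * r ^ Suc i"
  have nz: "fps_nth f (Suc i) \<noteq> 0"
    using order_le_less_trans[OF _ less[of "Suc (Suc i)"], of 0] r by auto
  have i: "vabs (fps_nth (quot f x) i) = vabs (fps_nth f (Suc i))"
    using less x r nz by (intro vabs_quot_nth_dominant[of _ _ r] f) auto
  have "vabs (fps_nth (quot f x) n) * r ^ Suc n < ?M" if "n \<noteq> i" for n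
  proof (cases "n < i")
    case True
    have "fps_nth (quot f x) n * x ^ Suc n = - (\<Sum>m\<le>n. fps_nth f m * x ^ m)"
      using quot_partial_sum[OF f, of x n] x(2) by (simp add: eq_neg_iff_add_eq_0 add.commute)
    then have "vabs (fps_nth (quot f x) n * x ^ Suc n) = vabs (\<Sum>m\<le>n. fps_nth f m * x ^ m)"
      by simp
    also have "\<dots> < ?M"
      using True x r nz less by (intro vabs_sum_less) (auto simp: vabs_mult vabs_power)
    finally show ?thesis using x by (simp add: vabs_mult vabs_power)
  next
    case False
    then show ?thesis using that x r less by (intro vabs_quot_nth_less f) auto
  qed
  then have "entire_eval (quot f x) y \<noteq> 0"
    using i y r by (intro vabs_entire_eval_dominant[where i = i] entire_quot f)
      (auto simp: mult.left_commute[of _ r])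
  then show False using \<open>entire_eval (quot f x) y = 0\<close> by simp
qed

text \<open>An edge of the Newton polygon: start from the last maximal index \<open>i\<close> at
  radius \<open>R\<close> and enlarge the radius until a later term first catches up. Infinitely
  many nonzero coefficients guarantee that one does.\<close>

lemma critical_radius:
  assumes f: "entire (f::'a fps)" and inf: "infinite {n. fps_nth f n \<noteq> 0}" and R: "R > 0"
  obtains r i j where "r > R" "i < j"
    "vabs (fps_nth f j) * r ^ j = vabs (fps_nth f i) * r ^ i"
    "\<And>n. vabs (fps_nth f n) * r ^ n \<le> vabs (fps_nth f i) * r ^ i"
    "\<And>n. n < i \<Longrightarrow> vabs (fps_nth f n) * r ^ n < vabs (fps_nth f i) * r ^ i"
proof -
  define a where "a = (\<lambda>n. vabs (fps_nth f n))"
  have "f \<noteq> 0" using inf by auto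
  then obtain i where i: "a i > 0" "\<And>n. a n * R ^ n \<le> a i * R ^ i"
    "\<And>n. n > i \<Longrightarrow> a n * R ^ n < a i * R ^ i"
    using ex_dominant[OF f _ R] unfolding dominant_def a_def by (metis vabs_pos_iff)
  \<comment> \<open>The radius at which the terms of index \<open>i\<close> and \<open>j\<close>
    have the same size.\<close>
  define \<rho> where "\<rho> = (\<lambda>j. root (j - i) (a i / a j))"
  have \<rho>: "\<rho> j > 0" "a j * \<rho> j ^ j = a i * \<rho> j ^ i" if "j > i" "a j > 0" for j
  proof -
    show "\<rho> j > 0" using that i by (simp add: \<rho>_def)
    have "\<rho> j ^ (j - i) = a i / a j"
      unfolding \<rho>_def using that i by (intro real_root_pow_pos2) auto
    then have "a j * \<rho> j ^ (j - i) * \<rho> j ^ i = a i * \<rho> j ^ i" using that by simp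
    then show "a j * \<rho> j ^ j = a i * \<rho> j ^ i"
      using that by (simp add: mult.assoc flip: power_add)
  qed
  obtain j0 where j0: "j0 > i" "a j0 > 0"
    using inf unfolding infinite_nat_iff_unbounded a_def by auto
  define s where "s = \<rho> j0"
  \<comment> \<open>Only indices that have caught up by radius \<open>s\<close> compete for the
    minimum. They are finitely many because the terms tend to 0 there; every other later term is
    still below term \<open>i\<close> at \<open>s\<close>.\<close>
  define J where "J = {j. j > i \<and> a j * s ^ j \<ge> a i * s ^ i}"
  have s: "s > 0" using \<rho>(1)[OF j0] by (simp add: s_def)
  have pos: "a i * t ^ i > 0" if "t > 0" for t using i that by simp
  have "(\<lambda>n. a n * s ^ n) \<longlonglongrightarrow> 0" using f s by (simp add: entire_iff a_def)
  then obtain K where K: "\<And>n. n \<ge> K \<Longrightarrow> a n * s ^ n < a i * s ^ i"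
    using order_tendstoD(2)[OF _ pos[OF s], of "\<lambda>n. a n * s ^ n" sequentially]
    by (auto simp: eventually_sequentially)
  have "J \<subseteq> {..<K}" using K by (force simp: J_def not_less[symmetric])
  then have finJ: "finite J" by (rule finite_subset) simp
  have j0J: "j0 \<in> J" using j0 \<rho>(2)[OF j0] by (simp add: J_def s_def)
  have Jpos: "j > i" "a j > 0" if "j \<in> J" for j
  proof -
    show "j > i" using that by (simp add: J_def)
    have "a j \<noteq> 0" using that pos[OF s] by (auto simp: J_def)
    then show "a j > 0" by (simp add: a_def)
  qed
  define r where "r = Min (\<rho> ` J)"
  have "r \<in> \<rho> ` J" unfolding r_def using finJ j0J by (intro Min_in) auto
  then obtain j where j: "j \<in> J" "r = \<rho> j" by auto
  have r_le: "r \<le> \<rho> k" if "k \<in> J" for k unfolding r_def using finJ that by (intro Min_le) auto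
  have r0: "r > 0" using \<rho>(1) Jpos j by auto
  have eq: "a j * r ^ j = a i * r ^ i" using \<rho>(2) Jpos j by auto
  have rR: "r > R"
  proof (rule ccontr)
    assume "\<not> r > R"
    then have "r < R \<or> r = R" by auto
    then have "a i * R ^ i \<le> a j * R ^ j"
      using power_dominance_mono[of i j r R "a j" "a i"] Jpos[OF j(1)] r0 eq by auto
    then show False using i(3)[OF Jpos(1)[OF j(1)]] by simp
  qed
  have lt: "a n * r ^ n < a i * r ^ i" if "n < i" for n
    using power_dominance_mono[OF that R rR i(1) i(2)] .
  have le: "a n * r ^ n \<le> a i * r ^ i" for n
  proof (rule ccontr)
    assume *: "\<not> ?thesis"
    then have "a n \<noteq> 0" using pos[OF r0] by auto
    then have n: "n > i" "a n > 0" using * lt[of n] by (cases n i rule: linorder_cases; simp add: a_def)+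
    have grow: "a i * t ^ i < a n * t ^ n" if "t \<ge> r" for t
      using power_dominance_mono[OF n(1) r0 _ n(2), of t "a i"] * that by (cases "t = r") auto
    \<comment> \<open>A later term that exceeds term \<open>i\<close> at \<open>r\<close> does so at
      all larger radii. This fails at \<open>\<rho> n\<close> if \<open>n\<close> is in
      \<open>J\<close>, and at \<open>s\<close> otherwise.\<close>
    show False
    proof (cases "n \<in> J")
      case True
      then show ?thesis using grow[OF r_le] \<rho>(2) n by fastforce
    next
      case False
      then show ?thesis using grow[of s] r_le[OF j0J] n by (auto simp: J_def s_def)
    qed
  qed
  show ?thesis using that[OF rR Jpos(1)[OF j(1)]] eq le lt unfolding a_def by blast
qed

end

section \<open>Zeros of series over an algebraically closed field\<close>

locale alg_closed_nonarchimedean_field = nonarchimedean_field T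
  for T :: "'a::complete_valued_field itself" +
  assumes ex_poly_root: "degree (P :: 'a poly) > 0 \<Longrightarrow> \<exists>x. poly P x = 0"
begin

text \<open>All roots lie outside the disc, so in each factor X - b the constant term is strictly
  dominant. The induction shows that this property passes to the product, one factor at a
  time.\<close>

lemma poly_no_root_disc:
  fixes P :: "'a poly"
  assumes "r > 0" and "P \<noteq> 0" and "\<And>x. vabs x \<le> r \<Longrightarrow> poly P x \<noteq> 0" and "n > 0"
  shows "vabs (coeff P n) * r ^ n < vabs (coeff P 0)"
  using assms(2-4)
proof (induction "degree P" arbitrary: P n)
  case 0
  then obtain c where "P = [:c:]" by (auto elim: degree_eq_zeroE)
  then show ?case using 0 by (auto simp: coeff_pCons split: nat.splits)
next
  case (Suc d)
  then obtain b where b: "poly P b = 0" using ex_poly_root[of P] by auto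
  then obtain Q where Q: "P = [:- b, 1:] * Q" by (auto simp: poly_eq_0_iff_dvd)
  then have Q0: "Q \<noteq> 0" using Suc by auto
  have "degree Q = d" using Suc.hyps(2) Q0 unfolding Q by (subst (asm) degree_mult_eq) auto
  moreover have "poly Q x \<noteq> 0" if "vabs x \<le> r" for x using Suc.prems(2)[OF that] unfolding Q by simp
  ultimately have IH: "vabs (coeff Q m) * r ^ m < vabs (coeff Q 0)" if "m > 0" for m
    using Suc.hyps(1) Q0 that by blast
  have br: "vabs b > r" using Suc.prems(2)[of b] b by force
  have Q00: "vabs (coeff Q 0) > 0" using order_le_less_trans[OF _ IH[of 1], of 0] assms(1) by simp
  obtain m where m: "n = Suc m" using Suc.prems(3) by (cases n) auto
  have "coeff P n = coeff Q m - b * coeff Q n" by (simp add: Q m)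
  then have "vabs (coeff P n) * r ^ n \<le> max (vabs (coeff Q m)) (vabs (b * coeff Q n)) * r ^ n"
    using vabs_diff_le[of "coeff Q m" "b * coeff Q n"] assms(1) by (intro mult_right_mono) auto
  also have "\<dots> = max (r * (vabs (coeff Q m) * r ^ m)) (vabs b * (vabs (coeff Q n) * r ^ n))"
    using assms(1) by (subst max_mult_distrib_right) (simp add: vabs_mult m ac_simps)
  also have "\<dots> < vabs b * vabs (coeff Q 0)"
    unfolding max_less_iff_conj
  proof
    have "r * (vabs (coeff Q m) * r ^ m) \<le> r * vabs (coeff Q 0)"
      using IH[of m] assms(1) by (intro mult_left_mono) (cases "m = 0"; force)+
    also have "\<dots> < vabs b * vabs (coeff Q 0)" using br Q00 by (intro mult_strict_right_mono)
    finally show "r * (vabs (coeff Q m) * r ^ m) < vabs b * vabs (coeff Q 0)" .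
    show "vabs b * (vabs (coeff Q n) * r ^ n) < vabs b * vabs (coeff Q 0)"
      using IH[OF Suc.prems(3)] br assms(1) by (intro mult_strict_left_mono) auto
  qed
  finally show ?case by (simp add: Q vabs_mult)
qed

lemma ex_zero_disc:
  assumes f: "entire (f::'a fps)" and r: "r > 0" and n: "n > 0"
    and le: "vabs (fps_nth f 0) \<le> vabs (fps_nth f n) * r ^ n"
  obtains x where "vabs x \<le> r" "entire_eval f x = 0"
proof (cases "fps_nth f 0 = 0")
  case True
  then show ?thesis using that[of 0] r by (simp add: entire_eval_0)
next
  case False
  then have f0: "f \<noteq> 0" by auto
  \<comment> \<open>The truncations retain the coefficients of index 0 and \<open>n\<close>, so
    \<open>le\<close> holds for each of them and \<open>poly_no_root_disc\<close> yields a root in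
    the disc.\<close>
  define P where "P = (\<lambda>m. truncate_fps (Suc n + m) f)"
  have coeff_P: "coeff (P m) k = (if k \<le> n + m then fps_nth f k else 0)" for m k
    by (simp add: P_def coeff_truncate_fps)
  have "\<exists>x. vabs x \<le> r \<and> poly (P m) x = 0" for m
  proof (rule ccontr)
    assume *: "\<not> ?thesis"
    have "P m \<noteq> 0" using False coeff_P[of m 0] by auto
    then have "vabs (coeff (P m) n) * r ^ n < vabs (coeff (P m) 0)"
      using * by (intro poly_no_root_disc r n) auto
    then show False using le by (simp add: coeff_P)
  qed
  then obtain x where x: "\<And>m. vabs (x m) \<le> r" "\<And>m. poly (P m) (x m) = 0" by metis
  have "(\<lambda>m. vabs (entire_eval f (x m))) \<longlonglongrightarrow> 0"
  proof (rule LIMSEQ_I)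
    fix e :: real assume e: "e > 0"
    have "(\<lambda>k. vabs (fps_nth f k) * r ^ k) \<longlonglongrightarrow> 0" using f r by (simp add: entire_iff)
    then obtain K where K: "\<And>k. k \<ge> K \<Longrightarrow> vabs (fps_nth f k) * r ^ k < e / 2"
      using order_tendstoD(2)[of _ 0 sequentially "e / 2"] e by (auto simp: eventually_sequentially)
    have "vabs (entire_eval f (x m)) \<le> e / 2" if "m \<ge> K" for m
    proof -
      have "entire_eval f (x m) = entire_eval (f - fps_of_poly (P m)) (x m)"
        using x(2) f by (simp add: entire_eval_diff entire_fps_of_poly entire_eval_fps_of_poly)
      also have "vabs \<dots> \<le> e / 2"
        using K that e
        by (intro vabs_entire_eval_le[OF entire_diff[OF f entire_fps_of_poly] x(1)])
          (auto simp: coeff_P intro: less_imp_le)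
      finally show ?thesis .
    qed
    then show "\<exists>K. \<forall>m\<ge>K. norm (vabs (entire_eval f (x m)) - 0) < e"
      using e by (intro exI[of _ K]) fastforce
  qed
  then have "(\<lambda>m. entire_eval f (x m)) \<longlonglongrightarrow> 0" by (simp add: tendsto_iff_vabs[of _ 0])
  from approximate_zeros_imp_zero[OF f f0 r x(1) this] that show ?thesis by blast
qed

text \<open>A strict inequality persists at a slightly smaller radius, where the version for closed
  discs applies.\<close>

lemma ex_zero_open_disc:
  assumes f: "entire (f::'a fps)" and r: "r > 0" and n: "n > 0"
    and less: "vabs (fps_nth f 0) < vabs (fps_nth f n) * r ^ n"
  obtains x where "vabs x < r" "entire_eval f x = 0"
proof -
  have "((\<lambda>s. vabs (fps_nth f n) * s ^ n) \<longlongrightarrow> vabs (fps_nth f n) * r ^ n) (at_left r)"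
    by (intro tendsto_intros)
  from order_tendstoD(1)[OF this less]
  have "\<forall>\<^sub>F s in at_left r. vabs (fps_nth f 0) < vabs (fps_nth f n) * s ^ n" .
  moreover have "\<forall>\<^sub>F s in at_left r. s \<in> {0<..<r}" using r by (intro eventually_at_leftI[of 0]) auto
  ultimately have "\<forall>\<^sub>F s in at_left r. vabs (fps_nth f 0) < vabs (fps_nth f n) * s ^ n \<and> s \<in> {0<..<r}"
    by (rule eventually_conj)
  then obtain s where s: "vabs (fps_nth f 0) < vabs (fps_nth f n) * s ^ n" "0 < s" "s < r"
    using eventually_happens'[of "at_left r"] by auto
  show ?thesis
  proof (rule ex_zero_disc[OF f s(2) n less_imp_le[OF s(1)]])
    fix x assume "vabs x \<le> s" "entire_eval f x = 0"
    then show ?thesis using s(3) by (intro that[of x]) auto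
  qed
qed

text \<open>The first maximal index \<open>i\<close> counts the zeros in the open disc. These are
  divided out one at a time; once the constant term is itself maximal, there is a zero in the closed
  disc but none in the open one.\<close>

lemma ex_zero_circle:
  assumes "entire (f::'a fps)" and "r > 0" and "i < j"
    and "vabs (fps_nth f j) * r ^ j = vabs (fps_nth f i) * r ^ i"
    and "\<And>n. vabs (fps_nth f n) * r ^ n \<le> vabs (fps_nth f i) * r ^ i"
    and "\<And>n. n < i \<Longrightarrow> vabs (fps_nth f n) * r ^ n < vabs (fps_nth f i) * r ^ i"
    and "fps_nth f i \<noteq> 0"
  obtains x where "vabs x = r" "entire_eval f x = 0"
  using assms
proof (induction i arbitrary: f j thesis)
  case 0
  obtain x where x: "vabs x \<le> r" "entire_eval f x = 0"
    using ex_zero_disc[OF 0(2,3) 0(4)] 0(5) by auto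
  have "\<not> vabs x < r"
  proof
    assume lt: "vabs x < r"
    have "vabs (fps_nth f n) * vabs x ^ n < vabs (fps_nth f 0)" if "n > 0" for n
    proof (cases "fps_nth f n = 0")
      case False
      then have "vabs (fps_nth f n) * vabs x ^ n < vabs (fps_nth f n) * r ^ n"
        using lt that by (intro mult_strict_left_mono power_strict_mono) auto
      then show ?thesis using 0(6)[of n] by simp
    qed (use 0(8) in simp)
    then have "dominant (vabs x) 0 f" using 0(8) by (auto simp: dominant_def)
    then show False using vabs_entire_eval_dominant_0[OF 0(2), of x "vabs x"] x 0(8) by simp
  qed
  then show ?case using 0(1) x by force
next
  case (Suc i)
  note f = Suc.prems(2) and r = Suc.prems(3)
  let ?M = "vabs (fps_nth f (Suc i)) * r ^ Suc i"
  have M: "?M > 0" using Suc.prems(8) r by simp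
  obtain j' where j': "j = Suc j'" "i < j'" using Suc.prems(4) by (cases j) auto
  obtain b where b: "vabs b < r" "entire_eval f b = 0"
    using ex_zero_open_disc[OF f r, of "Suc i"] Suc.prems(7)[of 0] by auto
  \<comment> \<open>Since |b| < r, all terms of a quotient coefficient after its first one carry a
    factor at most \<open>q\<close>, which is less than 1. Hence both maximal terms
    \<open>Suc i\<close> and \<open>j\<close> keep their size, although \<open>Suc i\<close> is not
    the last maximal index.\<close>
  define q where "q = vabs b / r"
  have q: "0 \<le> q" "q < 1" "vabs b = q * r" using b r by (simp_all add: q_def)
  have tail: "vabs (fps_nth f (Suc n + k) * b ^ k) * r ^ Suc n \<le> q * ?M" if "k > 0" for n k
  proof -
    have "vabs (fps_nth f (Suc n + k) * b ^ k) * r ^ Suc n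
        = q ^ k * (vabs (fps_nth f (Suc n + k)) * r ^ (Suc n + k))"
      by (simp add: vabs_mult vabs_power q(3) power_mult_distrib power_add ac_simps)
    also have "\<dots> \<le> q * ?M"
      using q that power_decreasing[of 1 k q] r by (intro mult_mono Suc.prems(6)) auto
    finally show ?thesis .
  qed
  have qM: "q * ?M < ?M" using mult_strict_right_mono[OF q(2) M] by simp
  have quot_nth: "fps_nth (quot f b) n = (\<Sum>k. fps_nth f (Suc n + k) * b ^ k)" for n
    by (simp add: quot_def)
  have eq: "vabs (fps_nth (quot f b) n) = vabs (fps_nth f (Suc n))"
    if "vabs (fps_nth f (Suc n)) * r ^ Suc n = ?M" for n
  proof -
    have "vabs (\<Sum>k. fps_nth f (Suc n + k) * b ^ k) = vabs (fps_nth f (Suc n + 0) * b ^ 0)"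
    proof (rule vabs_suminf_dominant[OF summable_quot[OF f]])
      fix k :: nat assume "k \<noteq> 0"
      then have "vabs (fps_nth f (Suc n + k) * b ^ k) * r ^ Suc n < vabs (fps_nth f (Suc n)) * r ^ Suc n"
        using order_le_less_trans[OF tail qM, of k n] unfolding that by simp
      then show "vabs (fps_nth f (Suc n + k) * b ^ k) < vabs (fps_nth f (Suc n + 0) * b ^ 0)"
        using r by (simp add: mult_less_cancel_right)
    qed (use that M in auto)
    then show ?thesis by (simp add: quot_nth)
  qed
  have eqi: "vabs (fps_nth (quot f b) i) = vabs (fps_nth f (Suc i))" by (rule eq) simp
  have M': "vabs (fps_nth (quot f b) i) * r ^ i = ?M / r" using r by (simp add: eqi)
  show ?case
  proof (rule Suc.IH[OF _ entire_quot[OF f] r j'(2)])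
    show "vabs (fps_nth (quot f b) j') * r ^ j' = vabs (fps_nth (quot f b) i) * r ^ i"
      using eq[of j'] eqi Suc.prems(5) r by (simp add: j'(1))
    show "fps_nth (quot f b) i \<noteq> 0" using eqi Suc.prems(8) by (metis vabs_eq_0_iff)
    show "vabs (fps_nth (quot f b) n) * r ^ n \<le> vabs (fps_nth (quot f b) i) * r ^ i" for n
      using vabs_quot_nth_le[OF f less_imp_le[OF b(1)] r Suc.prems(6), of n] r
      unfolding M' by (simp add: field_simps)
    show "vabs (fps_nth (quot f b) n) * r ^ n < vabs (fps_nth (quot f b) i) * r ^ i" if "n < i" for n
    proof -
      have "vabs (fps_nth f (Suc n + k) * b ^ k) * r ^ Suc n < ?M" for k
        using order_le_less_trans[OF tail qM, of k n] Suc.prems(7)[of "Suc n"] that by (cases "k = 0") auto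
      then have "vabs (\<Sum>k. fps_nth f (Suc n + k) * b ^ k) < ?M / r ^ Suc n"
        using r by (intro vabs_suminf_less summable_quot f) (simp add: pos_less_divide_eq)
      then have "vabs (fps_nth (quot f b) n) * r ^ Suc n < ?M"
        unfolding quot_nth using r by (simp only: pos_less_divide_eq zero_less_power)
      then show ?thesis using r unfolding M' by (simp add: field_simps)
    qed
    fix x assume x: "vabs x = r" "entire_eval (quot f b) x = 0"
    then have "entire_eval f x = 0" using entire_eval_division[OF f, of x b] b(2) by simp
    with x(1) show ?thesis by (rule Suc.prems(1))
  qed
qed

section \<open>Meromorphic functions\<close>

lemma fls_fraction_cross:
  fixes f g f' g' :: "'a fps"
  assumes "fps_to_fls f / fps_to_fls g = fps_to_fls f' / fps_to_fls g'" and "g \<noteq> 0" and "g' \<noteq> 0"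
  shows "f * g' = f' * g"
proof -
  have "fps_to_fls f * fps_to_fls g' = fps_to_fls f' * fps_to_fls g"
    using assms by (simp add: frac_eq_eq)
  then show ?thesis by (simp flip: fls_times_fps_to_fls)
qed

lemma has_valueI:
  assumes "entire f" and "entire g" and "F = fps_to_fls f / fps_to_fls g" and "entire_eval g x \<noteq> 0"
    and "entire_eval f x = y * entire_eval g (x::'a)"
  shows "has_value F x y"
  unfolding has_value_def using assms by (intro exI[of _ f] exI[of _ g]) simp

lemma entire_eval_nonzero_imp: "entire_eval f (x::'a) \<noteq> 0 \<Longrightarrow> f \<noteq> 0"
  by (auto simp: entire_eval_def)

text \<open>The product form covers representations whose denominator vanishes at \<open>x\<close>.
  It follows by cross-multiplication with a representation that is regular at
  \<open>x\<close>.\<close>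

lemma has_value_imp:
  assumes "has_value F x y" and f: "entire f" and g: "entire g" "g \<noteq> 0"
    and F: "F = fps_to_fls f / fps_to_fls g"
  shows "entire_eval f x = y * entire_eval g (x::'a)"
proof -
  obtain f' g' where *: "entire f'" "entire g'" "F = fps_to_fls f' / fps_to_fls g'"
    "entire_eval g' x \<noteq> 0" "y = entire_eval f' x / entire_eval g' x"
    using assms(1) unfolding has_value_def by blast
  have "f * g' = f' * g"
    using fls_fraction_cross[of f g f' g'] * F g entire_eval_nonzero_imp[OF *(4)] by simp
  then have "entire_eval f x * entire_eval g' x = entire_eval f' x * entire_eval g x"
    using * f g by (simp flip: entire_eval_mult)
  moreover have "entire_eval f' x = y * entire_eval g' x" using *(4,5) by simp
  ultimately have "entire_eval g' x * entire_eval f x = entire_eval g' x * (y * entire_eval g x)"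
    by (simp add: ac_simps)
  then show ?thesis using *(4) by simp
qed

lemma has_value_unique:
  assumes "has_value F x y" and "has_value F x z"
  shows "y = (z::'a)"
proof -
  obtain f g where "entire f" "entire g" "F = fps_to_fls f / fps_to_fls g" "entire_eval g x \<noteq> 0"
    "z = entire_eval f x / entire_eval g x"
    using assms(2) unfolding has_value_def by blast
  then show ?thesis using has_value_imp[OF assms(1), of f g] entire_eval_nonzero_imp by auto
qed

lemma mero_eval_eq_Some_iff: "mero_eval F (x::'a) = Some y \<longleftrightarrow> has_value F x y"
  unfolding mero_eval_def by (auto intro: theI has_value_unique the_equality)

lemma mero_eval_eq_None_iff: "mero_eval F (x::'a) = None \<longleftrightarrow> (\<nexists>y. has_value F x y)"
  unfolding mero_eval_def by auto

text \<open>Common zeros are cancelled only within a given disc, where they are finitely many; each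
  cancellation lowers the dominant index of the denominator.\<close>

lemma fraction_without_common_zeros:
  assumes "F \<in> meromorphic_functions" and r: "r > 0"
  obtains P Q where "entire P" "entire Q" "Q \<noteq> 0" "F = fps_to_fls P / fps_to_fls Q"
    "\<And>x::'a. vabs x \<le> r \<Longrightarrow> entire_eval Q x = 0 \<Longrightarrow> entire_eval P x \<noteq> 0"
proof -
  obtain P0 Q0 where "entire P0" "entire Q0" "Q0 \<noteq> 0" "F = fps_to_fls P0 / fps_to_fls Q0"
    using assms(1) by (auto simp: meromorphic_functions_def)
  moreover from this obtain d where "dominant r d Q0" using ex_dominant[OF _ _ r] by metis
  ultimately have "\<exists>P Q. entire P \<and> entire Q \<and> Q \<noteq> 0 \<and> F = fps_to_fls P / fps_to_fls Q \<and>
    (\<forall>x. vabs x \<le> r \<longrightarrow> entire_eval Q x = 0 \<longrightarrow> entire_eval P x \<noteq> 0)"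
  proof (induction d arbitrary: P0 Q0)
    case 0
    then have "\<forall>x. vabs x \<le> r \<longrightarrow> entire_eval Q0 x \<noteq> 0"
      using vabs_entire_eval_dominant_0[of Q0 _ r] by (fastforce simp: dominant_def)
    then show ?case using 0 by blast
  next
    case (Suc d)
    show ?case
    proof (cases "\<exists>b. vabs b \<le> r \<and> entire_eval Q0 b = 0 \<and> entire_eval P0 b = 0")
      case True
      then obtain b where b: "vabs b \<le> r" "entire_eval Q0 b = 0" "entire_eval P0 b = 0" by blast
      have "quot Q0 b \<noteq> 0" using fps_factor_root[OF Suc.prems(2) b(2)] Suc.prems(3) by auto
      moreover have "fps_X - fps_const b \<noteq> 0" using fps_factor_root[OF Suc.prems(2) b(2)] Suc.prems(3) by auto
      moreover have "F = (fps_to_fls (fps_X - fps_const b) * fps_to_fls (quot P0 b))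
          / (fps_to_fls (fps_X - fps_const b) * fps_to_fls (quot Q0 b))"
        using fps_factor_root[OF Suc.prems(1) b(3)] fps_factor_root[OF Suc.prems(2) b(2)] Suc.prems(4)
        by (metis fls_times_fps_to_fls)
      ultimately have "F = fps_to_fls (quot P0 b) / fps_to_fls (quot Q0 b)"
        by (metis fps_to_fls_eq_0_iff mult_divide_mult_cancel_left)
      then show ?thesis
        using Suc.IH[OF entire_quot[OF Suc.prems(1)] entire_quot[OF Suc.prems(2)] \<open>quot Q0 b \<noteq> 0\<close>]
          dominant_quot(1)[OF Suc.prems(2) b(1) r Suc.prems(5)] by blast
    qed (use Suc.prems in blast)
  qed
  then show ?thesis using that by blast
qed

section \<open>Absence and finiteness of zeros and poles\<close>

lemma zero_free_disc_imp_dominant: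
  assumes "entire (f::'a fps)" and "r > 0" and "\<And>x. vabs x \<le> r \<Longrightarrow> entire_eval f x \<noteq> 0" and "n > 0"
  shows "vabs (fps_nth f n) * r ^ n < vabs (fps_nth f 0)"
  using ex_zero_disc[OF assms(1,2,4)] assms(3) by (metis not_le)

text \<open>The candidate is the quotient of power series at 0, which is the same for all discs. On
  a given disc \<open>F\<close> is also P / Q with Q free of zeros, so the constant coefficient of Q
  dominates there, and division by Q preserves bounds on coefficients up to a constant
  factor.\<close>

lemma no_poles_imp_entire:
  assumes F: "F \<in> meromorphic_functions" and val: "\<And>x::'a. \<exists>y. has_value F x y"
  obtains w where "entire w" "F = fps_to_fls w"
proof -
  have rep: "\<exists>P Q. entire P \<and> entire Q \<and> Q \<noteq> 0 \<and> F = fps_to_fls P / fps_to_fls Q \<and>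
    (\<forall>x. vabs x \<le> r \<longrightarrow> entire_eval Q x \<noteq> 0)" if r: "r > 0" for r
  proof -
    obtain P Q where *: "entire P" "entire Q" "Q \<noteq> 0" "F = fps_to_fls P / fps_to_fls Q"
      "\<And>x::'a. vabs x \<le> r \<Longrightarrow> entire_eval Q x = 0 \<Longrightarrow> entire_eval P x \<noteq> 0"
      using fraction_without_common_zeros[OF F r] by blast
    have "entire_eval Q x \<noteq> 0" if "vabs x \<le> r" for x
    proof
      assume Q: "entire_eval Q x = 0"
      obtain y where "has_value F x y" using val by blast
      then show False using has_value_imp[OF _ *(1,2,3,4)] Q *(5)[OF that Q] by simp
    qed
    then show ?thesis using * by blast
  qed
  obtain P1 Q1 where 1: "entire P1" "entire Q1" "F = fps_to_fls P1 / fps_to_fls Q1"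
    "entire_eval Q1 0 \<noteq> 0"
    using rep[of 1] by (metis vabs_0 zero_le_one zero_less_one)
  define w where "w = P1 * inverse Q1"
  have "fps_nth Q1 0 \<noteq> 0" using 1(4) by (simp add: entire_eval_0)
  then have "w * Q1 = P1" by (simp add: w_def mult.assoc inverse_mult_eq_1)
  then have "fps_to_fls w * fps_to_fls Q1 = fps_to_fls P1" by (simp flip: fls_times_fps_to_fls)
  moreover have "fps_to_fls Q1 \<noteq> 0" using entire_eval_nonzero_imp[OF 1(4)] by simp
  ultimately have Fw: "F = fps_to_fls w" by (metis 1(3) nonzero_mult_div_cancel_right)
  have "entire w"
  proof (rule entireI_bounded)
    fix r :: real assume r: "r > 0"
    obtain P Q where *: "entire P" "entire Q" "Q \<noteq> 0" "F = fps_to_fls P / fps_to_fls Q"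
      "\<And>x::'a. vabs x \<le> r \<Longrightarrow> entire_eval Q x \<noteq> 0"
      using rep[OF r] by blast
    have dom: "vabs (fps_nth Q n) * r ^ n < vabs (fps_nth Q 0)" if "n > 0" for n
      using zero_free_disc_imp_dominant[OF *(2) r *(5) that] by simp
    have Q0: "vabs (fps_nth Q 0) > 0" using *(5)[of 0] r by (simp add: entire_eval_0)
    have "fps_to_fls w * fps_to_fls Q = fps_to_fls P" using *(3,4) Fw by simp
    then have wQ: "w * Q = P" by (simp flip: fls_times_fps_to_fls)
    obtain A where A: "\<And>n. vabs (fps_nth P n) * r ^ n \<le> A" "A > 0"
      using entire_bounded[OF *(1)] r by (metis less_imp_le)
    \<comment> \<open>The equation P = w Q is solved for \<open>fps_nth w n\<close>. The
      contributions of the earlier coefficients obey the same bound, and the ultrametric inequality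
      keeps them from accumulating.\<close>
    have "vabs (fps_nth w n) * r ^ n * vabs (fps_nth Q 0) \<le> A" for n
    proof (induction n rule: less_induct)
      case (less n)
      have "fps_nth P n = (\<Sum>i=0..n. fps_nth w i * fps_nth Q (n - i))"
        by (simp add: wQ[symmetric] fps_mult_nth)
      also have "\<dots> = (\<Sum>i<n. fps_nth w i * fps_nth Q (n - i)) + fps_nth w n * fps_nth Q 0"
        by (simp add: atLeast0AtMost lessThan_Suc_atMost[symmetric])
      finally have "fps_nth w n * fps_nth Q 0 = fps_nth P n - (\<Sum>i<n. fps_nth w i * fps_nth Q (n - i))"
        by simp
      then have "vabs (fps_nth w n * fps_nth Q 0)
          \<le> max (vabs (fps_nth P n)) (vabs (\<Sum>i<n. fps_nth w i * fps_nth Q (n - i)))"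
        by (simp only: vabs_diff_le)
      also have "\<dots> \<le> A / r ^ n"
      proof (rule max.boundedI)
        show "vabs (fps_nth P n) \<le> A / r ^ n" using A(1)[of n] r by (simp add: pos_le_divide_eq)
        show "vabs (\<Sum>i<n. fps_nth w i * fps_nth Q (n - i)) \<le> A / r ^ n"
        proof (rule vabs_sum_le)
          fix i assume "i \<in> {..<n}"
          then have i: "i < n" by simp
          have "vabs (fps_nth w i * fps_nth Q (n - i)) * r ^ n
              = (vabs (fps_nth w i) * r ^ i) * (vabs (fps_nth Q (n - i)) * r ^ (n - i))"
            using i by (simp add: vabs_mult power_add[symmetric] ac_simps)
          also have "\<dots> \<le> (vabs (fps_nth w i) * r ^ i) * vabs (fps_nth Q 0)"
            using dom[of "n - i"] i r by (intro mult_left_mono) auto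
          also have "\<dots> \<le> A" by (rule less[OF i])
          finally show "vabs (fps_nth w i * fps_nth Q (n - i)) \<le> A / r ^ n"
            using r by (simp add: pos_le_divide_eq)
        qed (use A r in simp)
      qed
      finally show ?case using r by (simp add: pos_le_divide_eq vabs_mult ac_simps)
    qed
    then have "vabs (fps_nth w n) * r ^ n \<le> A / vabs (fps_nth Q 0)" for n
      using Q0 by (simp add: pos_le_divide_eq)
    then show "\<exists>M. \<forall>n. vabs (fps_nth w n) * r ^ n \<le> M" by blast
  qed
  then show ?thesis using Fw by (rule that)
qed

text \<open>The constant term would have to dominate at every radius, but a nonzero term of positive
  index overtakes it eventually.\<close>

lemma zero_free_imp_const:
  assumes f: "entire (f::'a fps)" and nz: "\<And>x. entire_eval f x \<noteq> 0"
  obtains c where "f = fps_const c"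
proof -
  have "fps_nth f n = 0" if n: "n > 0" for n
  proof (rule ccontr)
    assume a: "fps_nth f n \<noteq> 0"
    define r where "r = max 1 (vabs (fps_nth f 0) / vabs (fps_nth f n))"
    have r: "r \<ge> 1" by (simp add: r_def)
    have "vabs (fps_nth f 0) \<le> vabs (fps_nth f n) * r"
      using a by (simp add: r_def field_simps max_def)
    also have "\<dots> \<le> vabs (fps_nth f n) * r ^ n"
      using r n by (intro mult_left_mono self_le_power) auto
    finally show False
      using zero_free_disc_imp_dominant[OF f _ nz n, of r] r by simp
  qed
  then have "f = fps_const (fps_nth f 0)" by (intro fps_ext) simp
  then show ?thesis by (rule that)
qed

lemma factor_zeros_disc:
  assumes "entire (f::'a fps)" and "f \<noteq> 0" and r: "r > 0"
  obtains q g where "q \<noteq> 0" "entire g" "f = fps_of_poly q * g" "\<And>x. vabs x \<le> r \<Longrightarrow> entire_eval g x \<noteq> 0"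
proof -
  obtain d where "dominant r d f" using ex_dominant[OF assms] .
  then have "\<exists>q g. q \<noteq> 0 \<and> entire g \<and> f = fps_of_poly q * g \<and> (\<forall>x. vabs x \<le> r \<longrightarrow> entire_eval g x \<noteq> 0)"
    using assms(1)
  proof (induction d arbitrary: f)
    case 0
    then have "\<forall>x. vabs x \<le> r \<longrightarrow> entire_eval f x \<noteq> 0"
      using vabs_entire_eval_dominant_0[of f _ r] by (fastforce simp: dominant_def)
    then show ?case using 0 by (intro exI[of _ 1] exI[of _ f]) simp
  next
    case (Suc d)
    show ?case
    proof (cases "\<exists>b. vabs b \<le> r \<and> entire_eval f b = 0")
      case True
      then obtain b where b: "vabs b \<le> r" "entire_eval f b = 0" by blast
      obtain q g where *: "q \<noteq> 0" "entire g" "quot f b = fps_of_poly q * g"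
        "\<forall>x. vabs x \<le> r \<longrightarrow> entire_eval g x \<noteq> 0"
        using Suc.IH[OF dominant_quot(1)[OF Suc.prems(2) b(1) r Suc.prems(1)] entire_quot[OF Suc.prems(2)]]
        by blast
      have "fps_of_poly [:- b, 1:] = fps_X - fps_const b"
        by (simp add: fps_of_poly_linear fps_const_neg[symmetric] del: fps_const_neg)
      then have "f = fps_of_poly ([:- b, 1:] * q) * g"
        using fps_factor_root[OF Suc.prems(2) b(2)] *(3) by (simp only: fps_of_poly_mult mult.assoc)
      moreover have "[:- b, 1:] * q \<noteq> 0" using *(1) by (simp only: mult_eq_0_iff pCons_eq_0_iff) simp
      ultimately show ?thesis using *(2,4) by blast
    next
      case False
      then show ?thesis using Suc.prems by (intro exI[of _ 1] exI[of _ f]) simp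
    qed
  qed
  then show ?thesis using that by blast
qed

lemma finite_bounded:
  assumes "finite (A::'a set)"
  obtains r where "r > 0" "\<And>x. x \<in> A \<Longrightarrow> vabs x \<le> r"
proof -
  define r where "r = 1 + sum vabs A"
  have "vabs x \<le> r" if "x \<in> A" for x
    using member_le_sum[OF that, of vabs] assms by (simp add: r_def)
  moreover have "r > 0" by (simp add: r_def add_pos_nonneg sum_nonneg)
  ultimately show ?thesis using that by blast
qed

lemma finite_zeros_imp_poly:
  assumes f: "entire (f::'a fps)" and fin: "finite {x. entire_eval f x = 0}"
  obtains p where "f = fps_of_poly p"
proof (cases "f = 0")
  case True
  then show ?thesis using that[of 0] by simp
next
  case False
  obtain r where r: "r > 0" "\<And>x. entire_eval f x = 0 \<Longrightarrow> vabs x \<le> r"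
    using finite_bounded[OF fin] by auto
  obtain q g where *: "entire g" "f = fps_of_poly q * g" "\<And>x. vabs x \<le> r \<Longrightarrow> entire_eval g x \<noteq> 0"
    using factor_zeros_disc[OF f False r(1)] by metis
  have "entire_eval g x \<noteq> 0" for x
    using r(2)[of x] *(3)[of x] entire_eval_mult[OF entire_fps_of_poly *(1), of q x] *(2) by auto
  then obtain c where "g = fps_const c" using zero_free_imp_const[OF *(1)] by blast
  then have "f = fps_of_poly (q * [:c:])" using *(2) by (simp only: fps_of_poly_mult fps_of_poly_const)
  then show ?thesis by (rule that)
qed

text \<open>The polynomial \<open>q\<close> carries the zeros of the denominator in a disc that
  contains all poles. The product of F and \<open>q\<close> then has no poles, hence is entire, and
  it has finitely many zeros, hence is a polynomial.\<close>

lemma finite_divisor_imp_rational: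
  assumes F: "F \<in> meromorphic_functions"
    and zeros: "finite {x::'a. has_value F x 0}" and poles: "finite {x. \<nexists>y. has_value F x y}"
  shows "rational_function F"
proof -
  obtain r where r: "r > 0" "\<And>x. (\<nexists>y. has_value F x y) \<Longrightarrow> vabs x \<le> r"
    using finite_bounded[OF poles] by auto
  obtain P Q where PQ: "entire P" "entire Q" "Q \<noteq> 0" "F = fps_to_fls P / fps_to_fls Q"
    using F by (auto simp: meromorphic_functions_def)
  obtain q Q2 where q: "q \<noteq> 0" "entire Q2" "Q = fps_of_poly q * Q2"
    "\<And>x. vabs x \<le> r \<Longrightarrow> entire_eval Q2 x \<noteq> 0"
    using factor_zeros_disc[OF PQ(2,3) r(1)] by blast
  define W where "W = fps_to_fls P / fps_to_fls Q2"
  have "fps_of_poly q \<noteq> 0" using q(1) fps_of_poly_eq_iff[of q 0] by simp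
  then have q0: "fps_to_fls (fps_of_poly q) \<noteq> 0" by simp
  have FW: "W = F * fps_to_fls (fps_of_poly q)"
    using q0 unfolding W_def PQ(4) q(3) fls_times_fps_to_fls by simp
  have "W \<in> meromorphic_functions"
    unfolding meromorphic_functions_def W_def using PQ q by auto
  moreover have "\<exists>y. has_value W x y" for x
  proof (cases "vabs x \<le> r")
    case True
    have "has_value W x (entire_eval P x / entire_eval Q2 x)"
      using q(4)[OF True] by (intro has_valueI[OF PQ(1) q(2) W_def]) auto
    then show ?thesis by blast
  next
    case False
    then obtain y where "has_value F x y" using r(2) by blast
    then obtain f g where fg: "entire f" "entire g" "F = fps_to_fls f / fps_to_fls g" "entire_eval g x \<noteq> 0"
      unfolding has_value_def by blast
    have "W = fps_to_fls (f * fps_of_poly q) / fps_to_fls g"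
      by (simp add: FW fg(3) fls_times_fps_to_fls)
    then have "has_value W x (entire_eval (f * fps_of_poly q) x / entire_eval g x)"
      using fg by (intro has_valueI[of "f * fps_of_poly q" g] entire_mult entire_fps_of_poly) auto
    then show ?thesis by blast
  qed
  ultimately obtain w where w: "entire w" "W = fps_to_fls w" using no_poles_imp_entire by blast
  have Fw: "F = fps_to_fls w / fps_to_fls (fps_of_poly q)"
    using FW w(2) q0 by (simp add: field_simps)
  have "{x. entire_eval w x = 0} \<subseteq> {x. has_value F x 0} \<union> {x. poly q x = 0}"
    using has_valueI[OF w(1) entire_fps_of_poly Fw] by (auto simp: entire_eval_fps_of_poly)
  then have "finite {x. entire_eval w x = 0}"
    using zeros poly_roots_finite[OF q(1)] by (meson finite_Un finite_subset)
  then obtain p where "w = fps_of_poly p" using finite_zeros_imp_poly[OF w(1)] by blast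
  then show ?thesis unfolding rational_function_def using Fw q(1) by blast
qed

section \<open>Right factors of functions with sparse zeros\<close>

definition sparse_zeros :: "'a fps \<Rightarrow> bool" where
  "sparse_zeros k \<longleftrightarrow> (\<exists>R. \<forall>x y. vabs x > R \<longrightarrow> vabs y = vabs x \<longrightarrow>
     entire_eval k x = 0 \<longrightarrow> entire_eval k y = 0 \<longrightarrow> x = y)"

text \<open>Near a pole the equation v = b becomes P - b Q = 0. For large b the series P - b Q
  inherits from Q a term of positive index at least as large as its constant term, and so has a zero
  in the disc.\<close>

lemma zeros_imp_no_pole:
  assumes k: "entire (k::'a fps)" "k \<noteq> 0" and v: "v \<in> meromorphic_functions"
    and B: "\<And>s. \<exists>b\<in>B. vabs b > s" and vB: "\<And>b x. b \<in> B \<Longrightarrow> has_value v x b \<Longrightarrow> entire_eval k x = 0"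
  shows "\<exists>y. has_value v x0 y"
proof (rule ccontr)
  assume pole: "\<nexists>y. has_value v x0 y"
  \<comment> \<open>Strictly larger than |x0|, so that the zero of Q at x0 makes some term of
    positive index strictly larger than the constant one at radius \<open>r\<close>.\<close>
  define r where "r = vabs x0 + 1"
  have r: "r > 0" "vabs x0 < r" by (simp_all add: r_def add_nonneg_pos)
  obtain P Q where PQ: "entire P" "entire Q" "Q \<noteq> 0" "v = fps_to_fls P / fps_to_fls Q"
    "\<And>x::'a. vabs x \<le> r \<Longrightarrow> entire_eval Q x = 0 \<Longrightarrow> entire_eval P x \<noteq> 0"
    using fraction_without_common_zeros[OF v r(1)] by blast
  have Qx0: "entire_eval Q x0 = 0"
  proof (rule ccontr)
    assume "entire_eval Q x0 \<noteq> 0"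
    then have "has_value v x0 (entire_eval P x0 / entire_eval Q x0)"
      by (intro has_valueI[OF PQ(1,2,4)]) auto
    then show False using pole by blast
  qed
  have "\<exists>n>0. vabs (fps_nth Q 0) < vabs (fps_nth Q n) * r ^ n"
  proof (rule ccontr)
    assume "\<not> ?thesis"
    then have le: "vabs (fps_nth Q n) * r ^ n \<le> vabs (fps_nth Q 0)" if "n > 0" for n
      using that by (metis not_less)
    have Q0: "fps_nth Q 0 \<noteq> 0"
    proof
      assume 0: "fps_nth Q 0 = 0"
      have "fps_nth Q n = 0" for n
      proof (cases "n = 0")
        case False
        then have "vabs (fps_nth Q n) * r ^ n = 0" using le[of n] 0 r(1) by (intro antisym) simp_all
        then show ?thesis using r(1) by simp
      qed (use 0 in simp)
      then show False using PQ(3) by (simp add: fps_eq_iff)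
    qed
    have "vabs (fps_nth Q n) * vabs x0 ^ n < vabs (fps_nth Q 0)" if "n > 0" for n
    proof (cases "fps_nth Q n = 0")
      case False
      then have "vabs (fps_nth Q n) * vabs x0 ^ n < vabs (fps_nth Q n) * r ^ n"
        using r that by (intro mult_strict_left_mono power_strict_mono) auto
      then show ?thesis using le[OF that] by simp
    qed (use Q0 in simp)
    then have "dominant (vabs x0) 0 Q" using Q0 by (auto simp: dominant_def)
    then show False using vabs_entire_eval_dominant_0[OF PQ(2) order_refl, of x0] Qx0 Q0 by simp
  qed
  then obtain n where n: "n > 0" "vabs (fps_nth Q 0) < vabs (fps_nth Q n) * r ^ n" by blast
  let ?q = "vabs (fps_nth Q n)"
  have q: "?q > 0" using order_le_less_trans[OF vabs_nonneg n(2)] r(1) by (simp add: zero_less_mult_iff)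
  \<comment> \<open>For |b| > s, the product of b with \<open>fps_nth Q n\<close> outweighs
    \<open>fps_nth P n\<close> and, with the factor \<open>r ^ n\<close>, also
    \<open>fps_nth P 0\<close>.\<close>
  define s where "s = max (vabs (fps_nth P n) / ?q) (vabs (fps_nth P 0) / (?q * r ^ n))"
  \<comment> \<open>\<open>E\<close> contains all values of \<open>v\<close> at zeros of
    \<open>k\<close> in the disc and is finite; \<open>b\<close> is taken beyond it.\<close>
  define E where "E = (\<lambda>x. entire_eval P x / entire_eval Q x) ` {x. vabs x \<le> r \<and> entire_eval k x = 0}"
  have "finite E" unfolding E_def by (intro finite_imageI finite_zeros_disc k)
  then obtain s' where s': "\<And>e. e \<in> E \<Longrightarrow> vabs e \<le> s'" using finite_bounded by metis
  obtain b where b: "b \<in> B" "vabs b > max s s'" using B by blast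
  define f where "f = P - fps_const b * Q"
  have f: "entire f" unfolding f_def by (intro entire_diff entire_mult entire_fps_const PQ)
  have eval_f: "entire_eval f x = entire_eval P x - b * entire_eval Q x" for x
    unfolding f_def
    by (simp add: entire_eval_diff entire_eval_mult entire_mult entire_fps_const entire_eval_fps_const PQ)
  have P: "vabs (fps_nth P n) < vabs b * ?q" "vabs (fps_nth P 0) < vabs b * (?q * r ^ n)"
    using b(2) q r(1) unfolding s_def by (simp_all add: pos_divide_less_eq)
  have "vabs (fps_nth f 0) \<le> max (vabs (fps_nth P 0)) (vabs (b * fps_nth Q 0))"
    unfolding f_def by (simp add: vabs_diff_le)
  also have "\<dots> \<le> vabs b * (?q * r ^ n)"
    using P(2) mult_left_mono[OF less_imp_le[OF n(2)] vabs_nonneg[of b]] by (simp add: vabs_mult)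
  also have "\<dots> = vabs (fps_nth f n) * r ^ n"
  proof -
    have "vabs (fps_nth f n) = vabs (- (b * fps_nth Q n) + fps_nth P n)" by (simp add: f_def)
    also have "\<dots> = vabs b * ?q" using P(1) by (subst vabs_add_eq_left) (simp_all add: vabs_mult)
    finally show ?thesis by simp
  qed
  finally obtain x where x: "vabs x \<le> r" "entire_eval f x = 0" using ex_zero_disc[OF f r(1) n(1)] by blast
  then have "entire_eval Q x \<noteq> 0" using PQ(5)[OF x(1)] by (auto simp: eval_f)
  moreover from this have "has_value v x b" using x(2) by (intro has_valueI[OF PQ(1,2,4)]) (auto simp: eval_f)
  ultimately have "b \<in> E" using vB[OF b(1)] x by (auto simp: E_def eval_f intro!: image_eqI[of _ _ x])
  then show False using s' b(2) by force
qed

lemma sparse_zeros_imp_rational: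
  assumes k: "entire (k::'a fps)" "k \<noteq> 0" "sparse_zeros k" and v: "v \<in> meromorphic_functions"
    and B: "\<And>s. \<exists>b\<in>B. vabs b > s" and vB: "\<And>b x. b \<in> B \<Longrightarrow> has_value v x b \<Longrightarrow> entire_eval k x = 0"
  shows "rational_function v"
proof -
  have "\<exists>y. has_value v x y" for x
    by (rule zeros_imp_no_pole[OF k(1,2) v B vB])
  then obtain w where w: "entire w" "v = fps_to_fls w" by (rule no_poles_imp_entire[OF v])
  have has: "has_value v x y" if "entire_eval w x = y" for x y
    using that entire_fps_const[of 1] entire_eval_fps_const[of 1 x] w
    by (intro has_valueI[of w "fps_const 1"]) auto
  show ?thesis
  proof (cases "finite {n. fps_nth w n \<noteq> 0}")
    case True
    then obtain r where r: "\<And>n. fps_nth w n \<noteq> 0 \<Longrightarrow> n \<le> r"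
      by (auto simp: finite_nat_set_iff_bounded_le)
    have "w = fps_of_poly (truncate_fps (Suc r) w)"
      using r by (intro fps_ext) (force simp: coeff_truncate_fps)
    then show ?thesis
      unfolding rational_function_def w(2) by (intro exI[of _ "truncate_fps (Suc r) w"] exI[of _ 1]) simp
  next
    case inf: False
    obtain R where R: "\<And>x y. vabs x > R \<Longrightarrow> vabs y = vabs x \<Longrightarrow> entire_eval k x = 0 \<Longrightarrow>
        entire_eval k y = 0 \<Longrightarrow> x = y"
      using k(3) unfolding sparse_zeros_def by blast
    obtain b1 b2 where b: "b1 \<in> B" "b2 \<in> B" "b1 \<noteq> b2" using B by (metis less_irrefl)
    obtain n where n: "n > 0" "fps_nth w n \<noteq> 0"
      using inf unfolding infinite_nat_iff_unbounded by auto
    \<comment> \<open>\<open>C\<close> bounds the constant term of w - b for both values b. At radii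
      beyond \<open>R'\<close> the largest term exceeds \<open>C\<close>, so subtracting b leaves
      the maximal indices unchanged and both values are taken on the same circle.\<close>
    define C where "C = vabs (fps_nth w 0) + vabs b1 + vabs b2"
    define R' where "R' = max R (max 1 (C / vabs (fps_nth w n)))"
    have R': "R' > 0" by (simp add: R'_def)
    obtain r i j where rij: "r > R'" "i < j"
      "vabs (fps_nth w j) * r ^ j = vabs (fps_nth w i) * r ^ i"
      "\<And>n. vabs (fps_nth w n) * r ^ n \<le> vabs (fps_nth w i) * r ^ i"
      "\<And>n. n < i \<Longrightarrow> vabs (fps_nth w n) * r ^ n < vabs (fps_nth w i) * r ^ i"
      by (rule critical_radius[OF w(1) inf R']) blast
    have r: "r > R" "r > 1" "C < vabs (fps_nth w n) * r"
      using rij(1) n(2) by (auto simp: R'_def field_simps)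
    note r(3)
    also have "vabs (fps_nth w n) * r \<le> vabs (fps_nth w n) * r ^ n"
      using r(2) n(1) by (intro mult_left_mono self_le_power) auto
    also have "\<dots> \<le> vabs (fps_nth w i) * r ^ i" by (rule rij(4))
    finally have C: "C < vabs (fps_nth w i) * r ^ i" .
    have i0: "i > 0"
    proof (rule ccontr)
      assume "\<not> ?thesis"
      then have "C < vabs (fps_nth w 0)" using C by simp
      then show False unfolding C_def using vabs_nonneg[of b1] vabs_nonneg[of b2] by linarith
    qed
    have "C \<ge> 0" by (simp add: C_def)
    then have wi: "fps_nth w i \<noteq> 0" using C by auto
    have zero: "\<exists>x. vabs x = r \<and> entire_eval w x = b" if "b = b1 \<or> b = b2" for b
    proof -
      define f where "f = w - fps_const b"
      have f: "entire f" unfolding f_def by (intro entire_diff entire_fps_const w)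
      have f_nth: "fps_nth f m = fps_nth w m" if "m > 0" for m using that by (simp add: f_def)
      have "vabs (fps_nth f 0) \<le> vabs (fps_nth w 0) + vabs b"
        using vabs_triangle[of "fps_nth w 0" "- b"] by (simp add: f_def)
      also have "\<dots> \<le> C" using that unfolding C_def by auto
      also note C
      finally have f0: "vabs (fps_nth f 0) < vabs (fps_nth w i) * r ^ i" .
      obtain x where "vabs x = r" "entire_eval f x = 0"
      proof (rule ex_zero_circle[OF f _ rij(2)])
        show "vabs (fps_nth f m) * r ^ m \<le> vabs (fps_nth f i) * r ^ i" for m
          using f0 rij(4)[of m] f_nth i0 by (cases "m = 0") auto
        show "vabs (fps_nth f m) * r ^ m < vabs (fps_nth f i) * r ^ i" if "m < i" for m
          using f0 rij(5)[OF that] f_nth i0 by (cases "m = 0") auto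
      qed (use rij(2,3) r(2) i0 wi f_nth in auto)
      then show ?thesis
        using w(1) by (auto simp: f_def entire_eval_diff entire_fps_const entire_eval_fps_const)
    qed
    obtain x1 where x1: "vabs x1 = r" "entire_eval w x1 = b1" using zero[of b1] by blast
    obtain x2 where x2: "vabs x2 = r" "entire_eval w x2 = b2" using zero[of b2] by blast
    have "x1 = x2"
      using x1 x2 r(1) vB[OF b(1) has] vB[OF b(2) has] by (rule_tac R) simp_all
    then show ?thesis using x1 x2 b(3) by simp
  qed
qed

lemma infinite_in_zeros_imp_unbounded:
  assumes "entire (f::'a fps)" and "f \<noteq> 0" and "infinite B" and "\<And>x. x \<in> B \<Longrightarrow> entire_eval f x = 0"
  shows "\<exists>b\<in>B. vabs b > s"
proof (rule ccontr)
  assume "\<not> ?thesis"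
  then have "B \<subseteq> {x. vabs x \<le> s \<and> entire_eval f x = 0}" using assms(4) by (auto simp: not_less)
  then show False using finite_zeros_disc[OF assms(1,2)] assms(3) finite_subset by blast
qed

text \<open>Zeros of \<open>u\<close> are pulled back by \<open>v\<close> to zeros of
  \<open>f\<close>, and poles of \<open>u\<close> to zeros of \<open>g\<close>; either case makes
  \<open>v\<close> rational.\<close>

theorem sparse_zeros_imp_pseudo_prime:
  assumes f: "entire (f::'a fps)" "f \<noteq> 0" "sparse_zeros f" and g: "entire g" "g \<noteq> 0" "sparse_zeros g"
  shows "pseudo_prime (fps_to_fls f / fps_to_fls g)"
  unfolding pseudo_prime_def
proof (intro conjI ballI impI)
  define h where "h = fps_to_fls f / fps_to_fls g"
  show "fps_to_fls f / fps_to_fls g \<in> meromorphic_functions"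
    unfolding meromorphic_functions_def using f g by blast
  fix u v :: "'a fls"
  assume u: "u \<in> meromorphic_functions" and v: "v \<in> meromorphic_functions"
    and "is_composition (fps_to_fls f / fps_to_fls g) u v"
  then have comp: "mero_eval h x = mero_eval u y" if "has_value v x y" for x y
    using that by (simp add: is_composition_def h_def mero_eval_eq_Some_iff)
  show "rational_function u \<or> rational_function v"
  proof (rule disjCI)
    assume nr: "\<not> rational_function v"
    show "rational_function u"
    proof (rule ccontr)
      assume nu: "\<not> rational_function u"
      obtain P Q where PQ: "entire P" "entire Q" "Q \<noteq> 0" "u = fps_to_fls P / fps_to_fls Q"
        using u by (auto simp: meromorphic_functions_def)
      consider "infinite {x. has_value u x 0}" | "infinite {x. \<nexists>y. has_value u x y}"
        using finite_divisor_imp_rational[OF u] nu by blast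
      then have "rational_function v"
      proof cases
        case 1
        have "P \<noteq> 0"
        proof
          assume "P = 0"
          then have "u = fps_to_fls (fps_of_poly 0) / fps_to_fls (fps_of_poly 1)" using PQ(4) by simp
          then show False using nu unfolding rational_function_def by (metis one_neq_zero)
        qed
        then show ?thesis
        proof (rule sparse_zeros_imp_rational[OF f v infinite_in_zeros_imp_unbounded[OF PQ(1) _ 1]])
          show "entire_eval P x = 0" if "x \<in> {x. has_value u x 0}" for x
            using has_value_imp[of u x 0 P Q] that PQ by simp
          show "entire_eval f x = 0" if "b \<in> {x. has_value u x 0}" "has_value v x b" for b x
          proof -
            have "has_value h x 0" using comp[OF that(2)] that(1) by (simp flip: mero_eval_eq_Some_iff)
            then show ?thesis using has_value_imp[OF _ f(1) g(1,2) h_def] by simp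
          qed
        qed
      next
        case 2
        show ?thesis
        proof (rule sparse_zeros_imp_rational[OF g v infinite_in_zeros_imp_unbounded[OF PQ(2,3) 2]])
          show "entire_eval Q x = 0" if "x \<in> {x. \<nexists>y. has_value u x y}" for x
          proof (rule ccontr)
            assume "entire_eval Q x \<noteq> 0"
            then have "has_value u x (entire_eval P x / entire_eval Q x)"
              by (intro has_valueI[OF PQ(1,2,4)]) auto
            then show False using that by blast
          qed
          \<comment> \<open>Since \<open>u\<close> has a pole at b = v(x), the composition leaves
            \<open>h\<close> without a value at \<open>x\<close>; if g(x) were nonzero, f(x) / g(x)
            would be one.\<close>
          show "entire_eval g x = 0" if "b \<in> {x. \<nexists>y. has_value u x y}" "has_value v x b" for b x
          proof (rule ccontr)
            assume "entire_eval g x \<noteq> 0"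
            then have "has_value h x (entire_eval f x / entire_eval g x)"
              by (intro has_valueI[OF f(1) g(1) h_def]) auto
            moreover have "\<nexists>y. has_value h x y"
              using comp[OF that(2)] that(1) mero_eval_eq_None_iff[of h x] mero_eval_eq_None_iff[of u b]
              by simp
            ultimately show False by blast
          qed
        qed
      qed
      then show False using nr by blast
    qed
  qed
qed

end

section \<open>Series with eventually convex exponents\<close>

text \<open>The second difference for exponent k + 1 is x times the one for exponent k plus (x +
  1)^k - (x - 1)^k, which is nonnegative.\<close>

lemma power_second_difference_ge:
  fixes x :: real
  assumes "x \<ge> 1"
  shows "(x + 1) ^ Suc (Suc m) + (x - 1) ^ Suc (Suc m) - 2 * x ^ Suc (Suc m) \<ge> 2 * x ^ m"
proof (induction m)
  case (Suc m)
  define k where "k = Suc (Suc m)"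
  have "x * (2 * x ^ m) \<le> x * ((x + 1) ^ k + (x - 1) ^ k - 2 * x ^ k)"
    using Suc assms unfolding k_def by (intro mult_left_mono) auto
  moreover have "(x - 1) ^ k \<le> (x + 1) ^ k" using assms by (intro power_mono) auto
  moreover have "(x + 1) ^ Suc k + (x - 1) ^ Suc k - 2 * x ^ Suc k
      = x * ((x + 1) ^ k + (x - 1) ^ k - 2 * x ^ k) + ((x + 1) ^ k - (x - 1) ^ k)"
    by (simp add: algebra_simps)
  ultimately show ?case unfolding k_def[symmetric] by simp
qed (simp add: power2_eq_square algebra_simps)

definition floor_exponent :: "nat \<Rightarrow> nat \<Rightarrow> nat" where
  "floor_exponent N n = nat \<lfloor>(real n / real N) ^ N\<rfloor>"

lemma mono_floor_exponent: "mono (floor_exponent N)"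
  unfolding floor_exponent_def by (intro monoI nat_mono floor_mono power_mono divide_right_mono) auto

text \<open>Rounding down lowers a second difference by less than 2, so it suffices that the real
  one is at least 2. Up to the denominator N^N it is at least 2 x^(N-2), and N - 2 is positive; the
  threshold N^N absorbs the denominator.\<close>

lemma floor_exponent_eventually_convex:
  assumes N: "N \<ge> 3"
  obtains n0 where "\<And>n. n \<ge> n0 \<Longrightarrow> floor_exponent N (Suc n) - floor_exponent N n
    < floor_exponent N (Suc (Suc n)) - floor_exponent N (Suc n)"
proof -
  define \<phi> where "\<phi> = (\<lambda>n::nat. (real n / real N) ^ N)"
  have conv: "\<phi> (Suc (Suc n)) + \<phi> n - 2 * \<phi> (Suc n) \<ge> 2" if n: "n \<ge> N ^ N" for n
  proof -
    obtain m where m: "N = Suc (Suc m)" "m \<ge> 1" using N by (intro that[of "N - 2"]) auto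
    define x where "x = real (Suc n)"
    have x: "x \<ge> 1" by (simp add: x_def)
    have "real N ^ N \<le> x" unfolding x_def using n by (metis le_SucI of_nat_le_iff of_nat_power)
    then have "2 * real N ^ N \<le> 2 * x" by simp
    also have "2 * x \<le> 2 * x ^ m" using x m(2) by (simp add: self_le_power)
    also have "\<dots> \<le> (x + 1) ^ N + (x - 1) ^ N - 2 * x ^ N"
      unfolding m(1) by (rule power_second_difference_ge[OF x])
    also have "\<dots> = real N ^ N * (\<phi> (Suc (Suc n)) + \<phi> n - 2 * \<phi> (Suc n))"
      using N by (simp add: \<phi>_def x_def power_divide field_simps)
    finally have "real N ^ N * 2 \<le> real N ^ N * (\<phi> (Suc (Suc n)) + \<phi> n - 2 * \<phi> (Suc n))"
      by (simp add: mult.commute)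
    then show ?thesis using N by (subst (asm) mult_le_cancel_left_pos) auto
  qed
  have e: "int (floor_exponent N n) = \<lfloor>\<phi> n\<rfloor>" for n
    by (simp add: floor_exponent_def \<phi>_def)
  have "floor_exponent N (Suc n) - floor_exponent N n
    < floor_exponent N (Suc (Suc n)) - floor_exponent N (Suc n)" if n: "n \<ge> N ^ N" for n
  proof -
    have "real_of_int (2 * \<lfloor>\<phi> (Suc n)\<rfloor>) < real_of_int (\<lfloor>\<phi> (Suc (Suc n))\<rfloor> + \<lfloor>\<phi> n\<rfloor>)"
      using conv[OF n] floor_correct[of "\<phi> n"] floor_correct[of "\<phi> (Suc n)"] floor_correct[of "\<phi> (Suc (Suc n))"]
      unfolding of_int_add of_int_mult by linarith
    then have "2 * floor_exponent N (Suc n) < floor_exponent N (Suc (Suc n)) + floor_exponent N n"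
      unfolding of_int_less_iff e[symmetric] by linarith
    moreover have "floor_exponent N n \<le> floor_exponent N (Suc n)"
      by (rule monoD[OF mono_floor_exponent]) simp
    ultimately show ?thesis by linarith
  qed
  then show ?thesis by (rule that)
qed

context nonarchimedean_field
begin

text \<open>The increments of the exponents eventually grow by at least one per step, so the ratio
  of consecutive terms tends to 0 at every radius.\<close>

lemma entire_of_convex_exponents:
  assumes "mono e" and conv: "\<And>n. n \<ge> n0 \<Longrightarrow> e (Suc n) - e n < e (Suc (Suc n)) - (e (Suc n) :: nat)"
    and a: "vabs (a::'a) < 1"
  shows "entire (Abs_fps (\<lambda>n. a ^ e n))"
  unfolding entire_iff fps_nth_Abs_fps vabs_power
proof (intro allI impI)
  fix r :: real assume r: "r \<ge> 0"
  define s where "s = (\<lambda>n. e (Suc n) - e n)"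
  have e_Suc: "e (Suc n) = e n + s n" for n using monoD[OF assms(1), of n "Suc n"] by (simp add: s_def)
  have s_ge: "s (n0 + k) \<ge> k" for k
  proof (induction k)
    case (Suc k)
    then show ?case using conv[of "n0 + k"] by (simp add: s_def)
  qed simp
  have "(\<lambda>k. vabs a ^ k * r) \<longlonglongrightarrow> 0"
    using tendsto_mult_left_zero[OF LIMSEQ_realpow_zero[OF vabs_nonneg a]] .
  then obtain K where K: "\<And>k. k \<ge> K \<Longrightarrow> vabs a ^ k * r < 1 / 2"
    using order_tendstoD(2)[of _ "0::real" sequentially "1 / 2"] by (auto simp: eventually_sequentially)
  have "summable (\<lambda>n. vabs a ^ e n * r ^ n)"
  proof (rule summable_ratio_test[of "1 / 2" "n0 + K"])
    fix n assume n: "n \<ge> n0 + K"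
    then have "s n \<ge> K" using s_ge[of "n - n0"] by simp
    then have "vabs a ^ s n * r \<le> 1 / 2" using K by (simp add: less_imp_le)
    then have "(vabs a ^ s n * r) * (vabs a ^ e n * r ^ n) \<le> 1 / 2 * (vabs a ^ e n * r ^ n)"
      using r by (intro mult_right_mono) auto
    then show "norm (vabs a ^ e (Suc n) * r ^ Suc n) \<le> 1 / 2 * norm (vabs a ^ e n * r ^ n)"
      using r by (simp add: e_Suc power_add abs_mult ac_simps)
  qed simp
  then show "(\<lambda>n. vabs a ^ e n * r ^ n) \<longlonglongrightarrow> 0" by (rule summable_LIMSEQ_zero)
qed

end

context alg_closed_nonarchimedean_field
begin

text \<open>On large circles the maximal terms have consecutive indices, because the exponents are
  eventually strictly convex.\<close>

lemma sparse_zeros_of_convex_exponents: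
  assumes "mono e" and conv: "\<And>n. n \<ge> n0 \<Longrightarrow> e (Suc n) - e n < e (Suc (Suc n)) - (e (Suc n) :: nat)"
    and a: "vabs (a::'a) < 1" "a \<noteq> 0"
  shows "sparse_zeros (Abs_fps (\<lambda>n. a ^ e n))"
proof -
  let ?A = "vabs a"
  define f where "f = Abs_fps (\<lambda>n. a ^ e n)"
  have f: "entire f" unfolding f_def by (rule entire_of_convex_exponents[OF assms(1) conv a(1)])
  have f0: "f \<noteq> 0" using a(2) by (auto simp: f_def fps_eq_iff)
  define s where "s = (\<lambda>n. e (Suc n) - e n)"
  have e_Suc: "e (Suc n) = e n + s n" for n using monoD[OF assms(1), of n "Suc n"] by (simp add: s_def)
  have s_less: "s n < s m" if "n \<ge> n0" "n < m" for n m
    using that(2)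
  proof (induction m)
    case (Suc m)
    have "s m < s (Suc m)" if "m \<ge> n0" using conv[OF that] by (simp add: s_def)
    then show ?case using Suc \<open>n \<ge> n0\<close> by (cases "m = n") auto
  qed simp
  \<comment> \<open>Convexity is known only from \<open>n0\<close> on. \<open>S\<close> bounds the
    increments up to \<open>n0\<close>, and for radii beyond \<open>R\<close> the corresponding
    ratios of consecutive terms exceed 1, which pushes the maximal term past
    \<open>n0\<close>.\<close>
  define S where "S = (\<Sum>n\<le>n0. s n)"
  define R where "R = 1 / ?A ^ S"
  have "x = y" if x: "vabs x > R" "vabs y = vabs x" "entire_eval f x = 0" "entire_eval f y = 0" for x y
  proof -
    define r where "r = vabs x"
    define t where "t = (\<lambda>n. vabs (fps_nth f n) * r ^ n)"
    have "R > 0" using a(2) by (simp add: R_def)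
    then have r: "r > 0" using x(1) by (simp add: r_def del: vabs_pos_iff)
    have t_pos: "t n > 0" for n using a(2) r by (simp add: t_def f_def)
    have t_Suc: "t (Suc n) = t n * (?A ^ s n * r)" for n
      by (simp add: t_def f_def vabs_power e_Suc power_add)
    have small: "?A ^ s n * r > 1" if "n \<le> n0" for n
    proof -
      have "s n \<le> S" unfolding S_def using that by (intro member_le_sum) auto
      then have "?A ^ S \<le> ?A ^ s n" using a by (intro power_decreasing) auto
      moreover have "?A ^ S * r > 1" using x(1) a(2) by (simp add: r_def R_def field_simps)
      ultimately show ?thesis using r by (meson less_le_trans mult_right_mono less_imp_le)
    qed
    obtain d where d: "dominant r d f" "\<And>n. t n \<le> t d"
      using ex_dominant[OF f f0 r] unfolding t_def by metis
    have "d > n0"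
    proof (rule ccontr)
      assume "\<not> d > n0"
      then have "t d < t (Suc d)" unfolding t_Suc using small[of d] t_pos[of d] by simp
      then show False using d(2)[of "Suc d"] by simp
    qed
    then obtain i where i: "d = Suc i" "i \<ge> n0" by (cases d) auto
    \<comment> \<open>Term \<open>Suc i\<close> is maximal, so this ratio is at least 1. Between
      \<open>n0\<close> and \<open>i\<close> the increments are smaller than \<open>s i\<close>,
      hence the ratios exceed 1, and all terms before \<open>i\<close> are strictly below term
      \<open>i\<close>.\<close>
    have "?A ^ s i * r \<ge> 1" using d(2)[of i] t_pos[of i] unfolding i(1) t_Suc by simp
    have grow: "t n < t (Suc n)" if "n < i" for n
    proof -
      have "?A ^ s n * r > 1"
      proof (cases "n \<le> n0")
        case False
        then have "s n < s i" using s_less[of n i] that by simp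
        then have "?A ^ s i < ?A ^ s n" using a by (intro power_strict_decreasing) auto
        then have "?A ^ s i * r < ?A ^ s n * r" using r by simp
        then show ?thesis using \<open>?A ^ s i * r \<ge> 1\<close> by simp
      qed (rule small)
      then show ?thesis unfolding t_Suc using t_pos[of n] by simp
    qed
    have t_less_i: "t n < t i" if "n < i" for n
    proof -
      have "n \<le> m \<Longrightarrow> Suc m \<le> i \<Longrightarrow> t n < t (Suc m)" for m
      proof (induction m)
        case (Suc m)
        then show ?case using grow[of "Suc m"] by (cases "n = Suc m") auto
      qed (use grow[of 0] in auto)
      from this[of "i - 1"] show ?thesis using that by simp
    qed
    show "x = y"
    proof (rule zero_on_circle_unique[OF f r])
      show "vabs (fps_nth f i) * r ^ i \<le> vabs (fps_nth f (Suc i)) * r ^ Suc i"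
        using d(2)[of i] by (simp only: t_def i)
      show "vabs (fps_nth f n) * r ^ n < vabs (fps_nth f (Suc i)) * r ^ Suc i" if "n \<noteq> i" "n \<noteq> Suc i" for n
      proof (cases "n < i")
        case True
        then show ?thesis using t_less_i[OF True] d(2)[of i] unfolding i(1) t_def by linarith
      next
        case False
        then show ?thesis using d(1) that unfolding dominant_def i(1) by auto
      qed
    qed (use x in \<open>simp_all add: r_def\<close>)
  qed
  then show ?thesis unfolding sparse_zeros_def f_def[symmetric] by blast
qed

text \<open>Beyond all roots the condition is vacuous. This serves the series \<open>g\<close> when
  \<beta> = 0.\<close>

lemma sparse_zeros_fps_of_poly:
  assumes "(p::'a poly) \<noteq> 0"
  shows "sparse_zeros (fps_of_poly p)"
proof -
  obtain R where "\<And>x. poly p x = 0 \<Longrightarrow> vabs x \<le> R"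
    using finite_bounded[OF poly_roots_finite[OF assms]] by auto
  then show ?thesis unfolding sparse_zeros_def entire_eval_fps_of_poly by (metis not_le)
qed

end

section \<open>The complex p-adic numbers\<close>

lemma alg_closed_nonarchimedean_field_Cp:
  assumes "is_Cp p TYPE('a::complete_valued_field)"
  shows "alg_closed_nonarchimedean_field TYPE('a)"
proof -
  have p: "prime p" and abs: "\<And>q. vabs (of_rat q :: 'a) = padic_abs p q"
    and alg: "alg_closed_subset (algebraic_over (padic_numbers :: 'a set))"
    and dense: "closure (algebraic_over (padic_numbers :: 'a set)) = UNIV"
    using assms by (auto simp: is_Cp_def)
  have nat_abs: "vabs (of_nat n :: 'a) = (if n = 0 then 0 else inverse (real p ^ multiplicity (int p) (int n)))" for n
  proof -
    have "vabs (of_nat n :: 'a) = padic_abs p (of_nat n)" using abs[of "of_nat n"] by simp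
    also have "\<dots> = (if n = 0 then 0 else inverse (real p ^ multiplicity (int p) (int n)))"
      using quotient_of_int[of "int n"] by (simp add: padic_abs_def power_int_minus Rat.of_int_def)
    finally show ?thesis .
  qed
  have p1: "real p \<ge> 1" "real p > 1" using prime_gt_1_nat[OF p] by simp_all
  have nat_le: "vabs (of_nat n :: 'a) \<le> 1" for n
    using one_le_power[OF p1(1), of "multiplicity (int p) (int n)"] by (simp add: nat_abs inverse_le_1_iff)
  interpret nonarchimedean_field "TYPE('a)"
  proof
    fix x y :: 'a
    define M where "M = max (vabs x) (vabs y)"
    have M: "M \<ge> 0" "vabs x \<le> M" "vabs y \<le> M" by (simp_all add: M_def le_max_iff_disj)
    \<comment> \<open>Binomial coefficients have absolute value at most 1. The linear factor n + 1
      is negligible against exponential growth, so the n-th powers yield the ultrametric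
      inequality.\<close>
    have bound: "vabs (x + y) ^ n \<le> (real n + 1) * M ^ n" for n
    proof -
      have sum_le: "vabs (sum t A) \<le> (\<Sum>i\<in>A. vabs (t i))" for t :: "nat \<Rightarrow> 'a" and A
      proof (induction A rule: infinite_finite_induct)
        case (insert i A)
        then show ?case using vabs_triangle[of "t i" "sum t A"] by simp
      qed simp_all
      have "vabs (x + y) ^ n = vabs (\<Sum>k\<le>n. of_nat (n choose k) * x ^ k * y ^ (n - k))"
        by (simp add: binomial_ring flip: vabs_power)
      also have "\<dots> \<le> (\<Sum>k\<le>n. vabs (of_nat (n choose k) * x ^ k * y ^ (n - k)))" by (rule sum_le)
      also have "\<dots> \<le> (\<Sum>k\<le>n. M ^ n)"
      proof (rule sum_mono)
        fix k assume "k \<in> {..n}"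
        have "vabs (of_nat (n choose k) * x ^ k * y ^ (n - k)) \<le> 1 * M ^ k * M ^ (n - k)"
          unfolding vabs_mult vabs_power using M nat_le by (intro mult_mono power_mono) auto
        then show "vabs (of_nat (n choose k) * x ^ k * y ^ (n - k)) \<le> M ^ n"
          using \<open>k \<in> {..n}\<close> by (simp flip: power_add)
      qed
      finally show ?thesis by (simp add: add.commute)
    qed
    show "vabs (x + y) \<le> max (vabs x) (vabs y)"
    proof (rule ccontr)
      assume "\<not> ?thesis"
      then have lt: "M < vabs (x + y)" unfolding M_def by (rule not_le_imp_less)
      define q where "q = M / vabs (x + y)"
      have pos: "0 < vabs (x + y)" using lt M(1) by (rule order_le_less_trans[rotated])
      have q: "0 \<le> q" "q < 1" using lt M(1) pos_divide_less_eq[OF pos, of M 1] by (simp_all add: q_def)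
      have "(\<lambda>n. (real n + 1) * q ^ n) \<longlonglongrightarrow> 0 + 0"
        unfolding distrib_right mult_1
        using powser_times_n_limit_0[of q] LIMSEQ_realpow_zero[OF q] q by (intro tendsto_add) auto
      moreover have "1 \<le> (real n + 1) * q ^ n" for n
        using bound[of n] pos_le_divide_eq[OF zero_less_power[OF pos, of n], of 1] by (simp add: q_def power_divide)
      ultimately show False using LIMSEQ_le_const[of _ "0 + 0" 1] by fastforce
    qed
    show "\<exists>x::'a. vabs x > 1"
    proof
      have "vabs (of_nat p :: 'a) = inverse (real p)"
        using p1 multiplicity_self[of "int p"] by (simp add: nat_abs)
      then show "vabs (inverse (of_nat p) :: 'a) > 1" using p1 by (simp add: vabs_inverse)
    qed
  qed
  have rat: "(of_rat q :: 'a) \<in> padic_numbers" for q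
    unfolding padic_numbers_def by (rule closure_subset[THEN subsetD]) (rule rangeI)
  have 01: "(0::'a) \<in> padic_numbers" "(1::'a) \<in> padic_numbers" "(-1::'a) \<in> padic_numbers"
    using rat[of 0] rat[of 1] rat[of "-1"] by simp_all
  have 0: "(0::'a) \<in> algebraic_over padic_numbers"
    unfolding algebraic_over_def using 01
    by (intro CollectI exI[of _ "[:0, 1:]"]) (auto simp: coeff_pCons split: nat.splits)
  have 1: "(1::'a) \<in> algebraic_over padic_numbers"
    unfolding algebraic_over_def using 01
    by (intro CollectI exI[of _ "[:- 1, 1:]"]) (auto simp: coeff_pCons split: nat.splits)
  show ?thesis
  proof
    fix P :: "'a poly" assume "degree P > 0"
    then obtain x where "poly P x = 0" using dense_alg_closed_subset_imp_root[OF alg dense 0 1] by blast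
    then show "\<exists>x. poly P x = 0" by blast
  qed
qed

theorem proposition2p14:
  fixes p N :: nat
    and \<alpha> \<beta> :: "'a::complete_valued_field"
    and f g :: "'a fps"
    and h :: "'a fls"
  assumes "is_Cp p TYPE('a)"
    and "N \<ge> 3"
    and "vabs \<beta> < vabs \<alpha>" and "vabs \<alpha> < 1"
    and "f = Abs_fps (\<lambda>n. \<alpha> ^ nat \<lfloor>(real n / real N) ^ N\<rfloor>)"
    and "g = Abs_fps (\<lambda>n. \<beta> ^ nat \<lfloor>(real n / real N) ^ N\<rfloor>)"
    and "h = fps_to_fls f / fps_to_fls g"
  shows "pseudo_prime h"
proof -
  interpret alg_closed_nonarchimedean_field "TYPE('a)"
    by (rule alg_closed_nonarchimedean_field_Cp[OF assms(1)])
  have f_def: "f = Abs_fps (\<lambda>n. \<alpha> ^ floor_exponent N n)" and g_def: "g = Abs_fps (\<lambda>n. \<beta> ^ floor_exponent N n)"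
    using assms(5,6) by (simp_all add: floor_exponent_def)
  obtain n0 where conv: "\<And>n. n \<ge> n0 \<Longrightarrow> floor_exponent N (Suc n) - floor_exponent N n
    < floor_exponent N (Suc (Suc n)) - floor_exponent N (Suc n)"
    using floor_exponent_eventually_convex[OF assms(2)] by blast
  note entire = entire_of_convex_exponents[OF mono_floor_exponent conv]
    and sparse = sparse_zeros_of_convex_exponents[OF mono_floor_exponent conv]
  have nz: "fps_nth f 0 \<noteq> 0" "fps_nth g 0 \<noteq> 0"
    using assms(2) by (simp_all add: f_def g_def floor_exponent_def power_0_left)
  have \<alpha>: "\<alpha> \<noteq> 0" using assms(3) order_le_less_trans[OF vabs_nonneg assms(3)] by auto
  have \<beta>: "vabs \<beta> < 1" using assms(3,4) by simp
  have f: "entire f" "sparse_zeros f" unfolding f_def by (rule entire sparse assms(4) \<alpha>; assumption?)+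
  have g: "entire g" unfolding g_def by (rule entire[OF _ \<beta>])
  have g': "sparse_zeros g"
  proof (cases "\<beta> = 0")
    case True
    \<comment> \<open>The exponent is 0 exactly for n < N, and \<open>0 ^ 0 = 1\<close>, so
      \<open>g\<close> is the polynomial 1 + X + ... + X^(N-1).\<close>
    have "floor_exponent N n > 0" if "n \<ge> N" for n
      using that assms(2) by (simp add: floor_exponent_def one_le_power)
    then have "g = fps_of_poly (truncate_fps N g)"
      using True by (intro fps_ext) (auto simp: g_def coeff_truncate_fps)
    moreover have "truncate_fps N g \<noteq> 0" using nz(2) calculation by (metis fps_of_poly_0 fps_zero_nth)
    ultimately show ?thesis using sparse_zeros_fps_of_poly by metis
  next
    case False
    then show ?thesis unfolding g_def by (intro sparse[OF _ \<beta>])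
  qed
  show ?thesis
    unfolding assms(7) using f g g' nz by (intro sparse_zeros_imp_pseudo_prime) auto
qed

end
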